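(* Let $f(z)=z+\sum_{n=2}^{\infty}a_nz^n\in \mathcal{S}_{S,e}^*$ with $a_2\in\mathbb{R}$ (equivalently, $\gamma_1$ and $\Gamma_1$ are real). Then $$-\frac{1}{16}\leq T_{2,1}(F_{f}/\gamma)\leq\frac{15}{256}\quad\text{and}\quad -\frac{1}{16}\leq T_{2,1}(F_{f^{-1}}/\Gamma)\leq\frac{15}{256}.$$ The lower and upper bounds are sharp.
   Context: $\mathbb{D}=\{z\in\mathbb{C}:|z|<1\}$. $\mathcal{S}$ is the class of univalent (injective) analytic functions $f$ on $\mathbb{D}$ with expansion $f(z)=z+\sum_{n\ge 2}a_nz^n$. For analytic $g,h$ on $\mathbb{D}$, $g\prec h$ (subordination) means $g=h\circ w$ for some analytic $w:\mathbb{D}\to\mathbb{D}$ with $w(0)=0$. The class is $$\mathcal{S}_{S,e}^*=\left\{f\in\mathcal{S}:\ \frac{2zf'(z)}{f(z)-f(-z)}\prec e^z\right\}.$$ For $f\in\mathcal{S}$, the logarithmic coefficients $\gamma_n$ are defined by $\log(f(z)/z)=2\sum_{n\ge1}\gamma_nz^n$, $z\in\mathbb{D}$. With $F=f^{-1}$ the inverse function near $0$ (defined for $|w|<1/4$), the logarithmic inverse coefficients $\Gamma_n$ are defined by $\log(F(w)/w)=2\sum_{n\ge1}\Gamma_nw^n$, $|w|<1/4$ (branches with $\log 1=0$). One has $\gamma_1=a_2/2$ and $\Gamma_1=-a_2/2$. The second Hermitian-Toeplitz determinants are $$T_{2,1}(F_f/\gamma)=\begin{vmatrix}\gamma_1&\gamma_2\\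 \overline{\gamma}_2&\gamma_1\end{vmatrix}=\gamma_1^2-|\gamma_2|^2,\qquad T_{2,1}(F_{f^{-1}}/\Gamma)=\begin{vmatrix}\Gamma_1&\Gamma_2\\ \overline{\Gamma}_2&\Gamma_1\end{vmatrix}=\Gamma_1^2-|\Gamma_2|^2,$$ where the diagonal entries are assumed real. "Sharp" means that each bound is attained by some function in the class. *)

theory Defs
  imports "HOL-Complex_Analysis.Complex_Analysis"
begin

abbreviation unit_disc :: "complex set" where
  "unit_disc \<equiv> ball 0 1"

definition class_S :: "(complex \<Rightarrow> complex) set" where
  "class_S = {f. f holomorphic_on unit_disc \<and> inj_on f unit_disc \<and> f 0 = 0 \<and> deriv f 0 = 1}"

definition taylor_coeff :: "(complex \<Rightarrow> complex) \<Rightarrow> nat \<Rightarrow> complex" where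
  "taylor_coeff f n = (deriv ^^ n) f 0 / fact n"

definition subordinate :: "(complex \<Rightarrow> complex) \<Rightarrow> (complex \<Rightarrow> complex) \<Rightarrow> bool"  (infix "\<prec>\<^sub>s" 50) where
  "g \<prec>\<^sub>s h \<longleftrightarrow> g holomorphic_on unit_disc \<and> h holomorphic_on unit_disc \<and>
     (\<exists>w. w holomorphic_on unit_disc \<and> w ` unit_disc \<subseteq> unit_disc \<and> w 0 = 0 \<and>
          (\<forall>z\<in>unit_disc. g z = h (w z)))"

text \<open>The quotient has a removable singularity at the origin, where its limit is
  \<open>2 f'(0) / (2 f'(0)) = 1\<close>. For univalent \<open>f\<close> the denominator has no other zero in the disc.\<close>

definition sym_quotient :: "(complex \<Rightarrow> complex) \<Rightarrow> complex \<Rightarrow> complex" where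
  "sym_quotient f z = (if z = 0 then 1 else 2 * z * deriv f z / (f z - f (- z)))"

definition class_S_sym_exp :: "(complex \<Rightarrow> complex) set" where
  "class_S_sym_exp = {f \<in> class_S. sym_quotient f \<prec>\<^sub>s exp}"

text \<open>\<open>L\<close> is the analytic branch of \<open>log (h z / z)\<close> on the disc of radius \<open>r\<close> with \<open>log 1 = 0\<close>
  (the value of \<open>h z / z\<close> at the origin is the limit, \<open>1\<close>). The series starts at
  index 1; the entry \<open>c 0\<close>, which has no meaning, is set to 0 to make \<open>c\<close> unique.\<close>

definition has_log_coeffs ::
    "(complex \<Rightarrow> complex) \<Rightarrow> real \<Rightarrow> (nat \<Rightarrow> complex) \<Rightarrow> bool" where
  "has_log_coeffs h r c \<longleftrightarrow> c 0 = 0 \<and>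
     (\<exists>L. L holomorphic_on ball 0 r \<and> L 0 = 0 \<and>
          (\<forall>z\<in>ball 0 r - {0}. exp (L z) = h z / z) \<and>
          (\<forall>z\<in>ball 0 r. (\<lambda>n. 2 * (c (Suc n) * z ^ Suc n)) sums L z))"

definition log_coeff :: "(complex \<Rightarrow> complex) \<Rightarrow> nat \<Rightarrow> complex" where
  "log_coeff f = (THE c. has_log_coeffs f 1 c)"

text \<open>By the Koebe one-quarter theorem, \<open>inv_into unit_disc f\<close> is a genuine inverse of
  \<open>f \<in> class_S\<close> on the disc of radius \<open>1/4\<close>.\<close>

definition log_inv_coeff :: "(complex \<Rightarrow> complex) \<Rightarrow> nat \<Rightarrow> complex" where
  "log_inv_coeff f = (THE c. has_log_coeffs (inv_into unit_disc f) (1/4) c)"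

definition hermitian_toeplitz_2_1 :: "(nat \<Rightarrow> complex) \<Rightarrow> complex" where
  "hermitian_toeplitz_2_1 c =
     det (vector [vector [c 1, c 2], vector [cnj (c 2), c 1]] :: complex ^ 2 ^ 2)"

end

theory Submission imports Defs begin

text \<open>If \<open>2 z f'(z) / (f(z) - f(-z)) = exp (w z)\<close> with a Schwarz function \<open>w = c\<^sub>1 z + c\<^sub>2 z^2 + \<dots>\<close>, then
  \<open>a\<^sub>2 = c\<^sub>1 / 2\<close> and \<open>a\<^sub>3 = c\<^sub>2 / 2 + c\<^sub>1^2 / 4\<close>, so that the second logarithmic coefficients of \<open>f\<close> and of its
  inverse are \<open>c\<^sub>1^2 / 16 + c\<^sub>2 / 4\<close> and \<open>c\<^sub>1^2 / 16 - c\<^sub>2 / 4\<close>; both bounds follow from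
  \<open>\<bar>c\<^sub>2\<bar> \<le> 1 - \<bar>c\<^sub>1\<bar>^2\<close>. In place of the Koebe theorem, the image of \<open>f\<close> is shown to contain the disc of
  radius \<open>1/4\<close> by means of the estimate \<open>\<bar>f'(z)\<bar> \<ge> exp (- 2 \<bar>z\<bar>)\<close>, which is special to this class. The
  extremal functions belong to \<open>w = z\<close> and \<open>w = z^2\<close>; their univalence is an instance of the
  Noshiro-Warschawski criterion.\<close>

subsection \<open>Univalence and coefficients of Schwarz functions\<close>

text \<open>If \<open>f x = f y\<close>, the mean value theorem for real parts, applied to
  \<open>f / (y - x)\<close> along the segment, gives a point \<open>u\<close> with
  \<open>Re (f' u) = 0\<close>; dividing by \<open>y - x\<close> cancels the increment.\<close>

lemma inj_on_if_Re_deriv_pos: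
  assumes "convex S" "\<And>z. z \<in> S \<Longrightarrow> (f has_field_derivative f' z) (at z)"
    and "\<And>z. z \<in> S \<Longrightarrow> 0 < Re (f' z)"
  shows "inj_on f S"
proof (rule inj_onI, rule ccontr)
  fix x y assume xy: "x \<in> S" "y \<in> S" "f x = f y" "x \<noteq> y"
  have seg: "closed_segment x y \<subseteq> S"
    using xy assms(1) by (simp add: closed_segment_subset)
  have "\<exists>u. u \<in> closed_segment x y \<and>
      Re (f y / (y - x)) - Re (f x / (y - x)) = Re (f' u / (y - x) * (y - x))"
    using seg assms(2) by (intro complex_mvt_line DERIV_cdivide) auto
  then obtain u where "u \<in> S" "0 = Re (f' u)"
    using xy seg by auto
  then show False using assms(3) by fastforce
qed

lemma fps_nth_fps_expansion_eq: "fps_nth (fps_expansion f 0) = taylor_coeff f"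
  by (simp add: fps_expansion_def taylor_coeff_def fun_eq_iff)

lemma taylor_coeff_eqI: "f has_fps_expansion F \<Longrightarrow> taylor_coeff f n = fps_nth F n"
  by (simp add: fps_nth_fps_expansion taylor_coeff_def)

lemma has_fps_expansion_disc:
  assumes "f holomorphic_on ball 0 r" "0 < r"
  shows "f has_fps_expansion fps_expansion f 0"
  using assms by (intro has_fps_expansion_fps_expansion[of "ball 0 r"]) auto

lemma has_fps_expansion_disc_cong:
  assumes "f has_fps_expansion F" "\<And>z. z \<in> ball 0 r \<Longrightarrow> f z = g z" "0 < r"
  shows "g has_fps_expansion F"
proof -
  have "\<forall>\<^sub>F z in nhds 0. f z = g z"
    using assms(2,3) by (intro eventually_nhds_in_open[THEN eventually_mono, of "ball 0 r"]) auto
  then show ?thesis using has_fps_expansion_cong[of f g F F] assms(1) by simp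
qed

text \<open>Factor \<open>w z = z * h z\<close>: the first two coefficients of \<open>w\<close> are
  \<open>h 0\<close> and \<open>deriv h 0\<close>, so the second bound is the Schwarz-Pick
  inequality for \<open>h\<close> at the origin, once the rotations are split off.\<close>

lemma Schwarz_second_coeff:
  assumes hol: "w holomorphic_on unit_disc" and sub: "w ` unit_disc \<subseteq> unit_disc" and w0: "w 0 = 0"
  shows "norm (taylor_coeff w 1) \<le> 1"
    and "norm (taylor_coeff w 2) \<le> 1 - (norm (taylor_coeff w 1))\<^sup>2"
proof -
  have lt: "norm (w z) < 1" if "norm z < 1" for z
    using that sub by (metis image_subset_iff mem_ball_0)
  obtain h where h: "h holomorphic_on unit_disc" "\<And>z. norm z < 1 \<Longrightarrow> w z = z * h z" "deriv w 0 = h 0"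
    using Schwarz3[OF hol w0] by blast
  have c1: "taylor_coeff w (Suc 0) = h 0" by (simp add: taylor_coeff_def h(3))
  show le1: "norm (taylor_coeff w 1) \<le> 1"
    using Schwarz_Lemma(2)[OF hol w0 lt, of 0] by (simp add: c1 h(3))
  have wX: "w has_fps_expansion fps_X * fps_expansion h 0"
    by (rule has_fps_expansion_disc_cong[where f = "\<lambda>z. z * h z" and r = 1],
        intro fps_expansion_intros has_fps_expansion_disc[OF h(1)]) (use h(2) in auto)
  have c2: "taylor_coeff w 2 = deriv h 0"
    by (simp add: taylor_coeff_eqI[OF wX] eval_nat_numeral)
       (simp add: fps_expansion_def)
  show "norm (taylor_coeff w 2) \<le> 1 - (norm (taylor_coeff w 1))\<^sup>2"
  proof (cases "\<exists>z. norm z < 1 \<and> norm (h z) \<ge> 1")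
    \<comment> \<open>A value of \<open>h\<close> of modulus at least 1 forces equality in the
      Schwarz lemma, so \<open>w\<close> is a rotation and its second coefficient vanishes.\<close>
    case True
    then obtain z where z: "norm z < 1" "norm (h z) \<ge> 1" by blast
    have zw: "norm z \<le> norm (w z)"
      using h(2)[OF z(1)] z(2) by (simp add: norm_mult mult_left_le mult_le_cancel_left1)
    have wz: "norm (w z) \<le> norm z"
      using Schwarz_Lemma(1)[OF hol w0 lt z(1)] .
    have "(\<exists>z. norm z < 1 \<and> z \<noteq> 0 \<and> norm (w z) = norm z) \<or> norm (deriv w 0) = 1"
    proof (cases "z = 0")
      case True then show ?thesis using z le1 c1 h(3) by simp
    next
      case False
      have "norm (w z) = norm z" using zw wz by (rule order_antisym[rotated])
      then show ?thesis using z(1) False by blast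
    qed
    then obtain \<alpha> where \<alpha>: "\<And>z. norm z < 1 \<Longrightarrow> w z = \<alpha> * z" "norm \<alpha> = 1"
      using Schwarz_Lemma(3)[OF hol w0 lt z(1)] by blast
    have "w has_fps_expansion fps_const \<alpha> * fps_X"
      by (rule has_fps_expansion_disc_cong[where f = "\<lambda>z. \<alpha> * z" and r = 1],
          intro fps_expansion_intros) (use \<alpha>(1) in auto)
    from taylor_coeff_eqI[OF this] \<alpha>(2) show ?thesis by simp
  next
    case False
    then have hlt: "norm (h z) < 1" if "norm z < 1" for z using that by force
    define a where "a = h 0"
    have a: "norm a < 1" using hlt[of 0] by (simp add: a_def)
    \<comment> \<open>This disc automorphism sends \<open>h 0\<close> to 0, so the Schwarz lemma
      bounds \<open>deriv g 0\<close>; its derivative at \<open>a\<close> is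
      \<open>1 / (1 - cnj a * a)\<close>, which produces the factor
      \<open>1 - (norm a)^2\<close>.\<close>
    define g where "g = Moebius_function 0 a \<circ> h"
    have g: "g holomorphic_on unit_disc"
      unfolding g_def using hlt h(1)
      by (intro holomorphic_on_compose_gen[OF _ Moebius_function_holomorphic[OF a]]) auto
    have g0: "g 0 = 0" by (simp add: g_def a_def Moebius_function_eq_zero)
    have glt: "norm (g z) < 1" if "norm z < 1" for z
      using Moebius_function_norm_lt_1[OF a hlt[OF that]] by (simp add: g_def)
    have aa: "1 - cnj a * a = of_real (1 - (norm a)\<^sup>2)"
      using complex_norm_square[of a] by (simp add: mult.commute)
    have pos: "0 < 1 - (norm a)\<^sup>2" using a by (simp add: abs_square_less_1)
    then have nz: "1 - cnj a * a \<noteq> 0" unfolding aa by (simp only: of_real_eq_0_iff)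
    have dh: "(h has_field_derivative deriv h 0) (at 0)"
      using h(1) by (intro holomorphic_derivI[of _ unit_disc]) auto
    have "((\<lambda>z. (z - a) / (1 - cnj a * z)) has_field_derivative
        (1 * (1 - cnj a * a) - (a - a) * (- cnj a)) / ((1 - cnj a * a) * (1 - cnj a * a))) (at a)"
      by (rule DERIV_divide) (use nz in \<open>auto intro!: derivative_eq_intros simp del: right_minus_eq\<close>)
    then have "(Moebius_function 0 a has_field_derivative 1 / (1 - cnj a * a)) (at (h 0))"
      using nz by (simp add: Moebius_function_def[abs_def] a_def)
    from DERIV_chain[OF this dh]
    have "(g has_field_derivative deriv h 0 / (1 - cnj a * a)) (at 0)" by (simp add: g_def)
    then have "norm (deriv h 0 / (1 - cnj a * a)) \<le> 1"
      using Schwarz_Lemma(2)[OF g g0 glt, of 0] by (simp add: DERIV_imp_deriv)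
    then show ?thesis
      using pos unfolding One_nat_def c1 c2 a_def[symmetric] aa norm_divide norm_of_real abs_of_pos[OF pos]
      by (simp only: pos_divide_le_eq mult_1_left)
  qed
qed

subsection \<open>A covering estimate for univalent functions\<close>

text \<open>Pulling the segment from the disc of radius \<open>d\<close> to a point of smallest modulus on the image
  of the sphere back to the annulus \<open>r \<le> norm z \<le> s\<close> costs length at least \<open>s - r\<close>.\<close>

lemma covering_step:
  fixes f :: "complex \<Rightarrow> complex"
  assumes hol: "f holomorphic_on unit_disc" and inj: "inj_on f unit_disc" and f0: "f 0 = 0"
    and rs: "0 \<le> r" "r < s" "s < 1" and m: "0 < m" "\<And>z. norm z \<le> s \<Longrightarrow> m \<le> norm (deriv f z)"
    and cov: "cball 0 d \<subseteq> f ` cball 0 r" and d: "0 \<le> d"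
  shows "cball 0 (d + (s - r) * m) \<subseteq> f ` cball 0 s"
proof -
  have sub: "cball 0 s \<subseteq> unit_disc" using rs by auto
  have contf: "continuous_on (cball 0 s) f"
    using hol sub by (meson holomorphic_on_imp_continuous_on holomorphic_on_subset)
  have "\<exists>z\<in>sphere 0 s. \<forall>y\<in>sphere 0 s. norm (f z) \<le> norm (f y)"
    using rs by (intro continuous_attains_inf continuous_intros continuous_on_subset[OF contf])
                (auto simp: sphere_eq_empty)
  then obtain z0 where z0: "norm z0 = s" and min: "\<And>y. norm y = s \<Longrightarrow> norm (f z0) \<le> norm (f y)"
    by auto
  define \<mu> where "\<mu> = norm (f z0)"
  have \<mu>: "0 < \<mu>"
    using inj_onD[OF inj, of z0 0] f0 z0 rs by (auto simp: \<mu>_def)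
  \<comment> \<open>The image of the open disc of radius \<open>s\<close> is open and its boundary
    values have modulus at least \<open>\<mu>\<close>, so no point of modulus below
    \<open>\<mu>\<close> is missed.\<close>
  have big: "ball 0 \<mu> \<subseteq> f ` cball 0 s"
  proof -
    have "ball (f 0) \<mu> \<subseteq> f ` cball 0 s"
    proof (rule ball_subset_open_map_image)
      have "f holomorphic_on ball 0 s"
        using hol sub by (meson ball_subset_cball holomorphic_on_subset)
      moreover have "\<not> f constant_on ball 0 s"
      proof
        assume "f constant_on ball 0 s"
        then obtain c where "\<And>z. norm z < s \<Longrightarrow> f z = c"
          unfolding constant_on_def by auto
        then have "f 0 = f (of_real (s / 2))" using rs by simp
        then show False
          using inj_onD[OF inj, of 0 "of_real (s/2)"] rs by auto
      qed
      ultimately show "open (f ` interior (cball 0 s))"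
        using open_mapping_thm[of f "ball 0 s" "ball 0 s"] by auto
      show "\<And>z. z \<in> frontier (cball 0 s) \<Longrightarrow> \<mu> \<le> norm (f z - f 0)"
        using min rs f0 by (auto simp: \<mu>_def dist_norm)
    qed (use contf rs \<mu> in auto)
    then show ?thesis by (simp add: f0)
  qed
  \<comment> \<open>The closed ball is needed because \<open>f z0\<close> lies on its boundary and
    is an endpoint of the segment used below.\<close>
  have big': "cball 0 \<mu> \<subseteq> f ` cball 0 s"
  proof -
    have "closed (f ` cball 0 s)"
      using contf by (intro compact_imp_closed compact_continuous_image) auto
    then have "closure (ball 0 \<mu>) \<subseteq> f ` cball 0 s" using big by (rule closure_minimal[rotated])
    then show ?thesis using \<mu> by simp
  qed
  obtain g where g: "g holomorphic_on f ` unit_disc"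
      "\<And>z. z \<in> unit_disc \<Longrightarrow> deriv f z * deriv g (f z) = 1" "\<And>z. z \<in> unit_disc \<Longrightarrow> g (f z) = z"
    using holomorphic_has_inverse[OF hol open_ball inj] by metis
  have opn: "open (f ` unit_disc)"
    using hol inj by (intro open_mapping_thm3) auto
  have gder: "(g has_field_derivative deriv g y) (at y)" if "y \<in> f ` cball 0 s" for y
    using that sub by (intro holomorphic_derivI[OF g(1) opn]) auto
  have gbd: "norm (deriv g y) \<le> 1 / m" if "y \<in> f ` cball 0 s" for y
  proof -
    from that obtain z where z: "norm z \<le> s" "y = f z" by auto
    have "deriv f z * deriv g (f z) = 1" using z rs by (intro g(2)) auto
    then have "norm (deriv f z) * norm (deriv g y) = 1" unfolding z(2) by (metis norm_mult norm_one)
    moreover have "m \<le> norm (deriv f z)" using m(2) z by auto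
    ultimately show ?thesis using m(1)
      mult_right_mono[of m "norm (deriv f z)" "norm (deriv g y)"] by (simp add: field_simps)
  qed
  have "d < \<mu>"
  proof (rule ccontr)
    assume "\<not> d < \<mu>"
    then have "f z0 \<in> f ` cball 0 r" using cov by (auto simp: \<mu>_def)
    then obtain z where "norm z \<le> r" "f z0 = f z" by auto
    then show False using inj_onD[OF inj, of z0 z] z0 rs by auto
  qed
  \<comment> \<open>\<open>p\<close> is the point of modulus \<open>d\<close> on the segment from 0
    to \<open>f z0\<close>. Its preimage \<open>z1\<close> has modulus at most \<open>r\<close> and
    \<open>z0\<close> has modulus \<open>s\<close>, so the inverse \<open>g\<close>, whose
    derivative is at most \<open>1 / m\<close>, moves by at least \<open>s - r\<close> over a length
    \<open>\<mu> - d\<close>.\<close>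
  define p where "p = of_real (d / \<mu>) * f z0"
  have np: "norm p = d" using \<mu> d by (simp add: p_def norm_mult norm_divide \<mu>_def)
  then have "p \<in> f ` cball 0 r" using cov by auto
  then obtain z1 where z1: "norm z1 \<le> r" "f z1 = p" by (auto elim!: imageE)
  have "norm (g (f z0) - g p) \<le> 1 / m * norm (f z0 - p)"
  proof (rule field_differentiable_bound[where S = "cball 0 \<mu>" and f' = "deriv g"])
    show "p \<in> cball 0 \<mu>" using np \<open>d < \<mu>\<close> by auto
    show "f z0 \<in> cball 0 \<mu>" by (simp add: \<mu>_def)
  next
    fix y :: complex assume "y \<in> cball 0 \<mu>"
    then have "y \<in> f ` cball 0 s" using big' by blast
    then show "(g has_field_derivative deriv g y) (at y within cball 0 \<mu>)" "norm (deriv g y) \<le> 1 / m"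
      using has_field_derivative_at_within[OF gder] gbd by simp_all
  qed auto
  moreover have "g (f z0) = z0" "g p = z1"
    using g(3)[of z0] g(3)[of z1] z0 z1 rs by auto
  moreover have "norm (f z0 - p) = \<mu> - d"
  proof -
    have "f z0 - p = of_real (1 - d / \<mu>) * f z0" by (simp add: p_def algebra_simps)
    also have "norm \<dots> = (1 - d / \<mu>) * \<mu>"
      unfolding norm_mult norm_of_real \<mu>_def[symmetric] using \<mu> \<open>d < \<mu>\<close> by simp
    finally show ?thesis using \<mu> by (simp add: left_diff_distrib)
  qed
  moreover have "s - r \<le> norm (z0 - z1)"
    using norm_triangle_ineq2[of z0 z1] z0 z1 by linarith
  ultimately have "s - r \<le> (\<mu> - d) / m" by simp
  then have "(s - r) * m \<le> \<mu> - d" using m(1) by (simp add: field_simps)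
  then have "cball (0::complex) (d + (s - r) * m) \<subseteq> cball 0 \<mu>" by (intro subset_cball) linarith
  then show ?thesis using big' by (rule order_trans)
qed

subsection \<open>Logarithmic coefficients\<close>

text \<open>The coefficient form of \<open>z h' = h (1 + z L')\<close>, where \<open>h = z exp L\<close>; it avoids composing with \<open>exp\<close>.\<close>

lemma log_coeffs_fps:
  assumes h: "h holomorphic_on ball 0 r" "h 0 = 0" "0 < r" and c: "has_log_coeffs h r c"
  shows "fps_X * fps_deriv (fps_expansion h 0) =
    fps_expansion h 0 * (1 + fps_X * fps_deriv (Abs_fps (\<lambda>n. 2 * c n)))"
proof -
  define \<Lambda> where "\<Lambda> = Abs_fps (\<lambda>n. 2 * c n)"
  from c obtain L where c0: "c 0 = 0" and L: "L holomorphic_on ball 0 r"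
      "\<And>z. z \<in> ball 0 r - {0} \<Longrightarrow> exp (L z) = h z / z"
      "\<And>z. z \<in> ball 0 r \<Longrightarrow> (\<lambda>n. 2 * (c (Suc n) * z ^ Suc n)) sums L z"
    unfolding has_log_coeffs_def by blast
  have "(\<lambda>n. fps_nth \<Lambda> n * z ^ n) sums L z" if "z \<in> ball 0 r" for z
    using L(3)[OF that] c0 sums_Suc_iff[of "\<lambda>n. 2 * (c n * z ^ n)"] by (simp add: \<Lambda>_def mult.assoc)
  then have Lf: "L has_fps_expansion \<Lambda>"
    using h(3) by (intro has_fps_expansionI eventually_nhds_in_open[THEN eventually_mono, of "ball 0 r"]) auto
  have heq: "h z = z * exp (L z)" if "z \<in> ball 0 r" for z
    using L(2)[of z] that h(2) by (cases "z = 0") auto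
  have eq: "z * deriv h z = h z * (1 + z * deriv L z)" if z: "z \<in> ball 0 r" for z
  proof -
    have "(L has_field_derivative deriv L z) (at z)"
      using L(1) z by (intro holomorphic_derivI[of _ "ball 0 r"]) auto
    then have "((\<lambda>z. z * exp (L z)) has_field_derivative (exp (L z) * (1 + z * deriv L z))) (at z)"
      by (auto intro!: derivative_eq_intros simp: algebra_simps)
    then have "(h has_field_derivative (exp (L z) * (1 + z * deriv L z))) (at z)"
      using z heq has_field_derivative_transform_within_open[of _ _ z "ball 0 r" h] by auto
    then show ?thesis using heq[OF z] by (simp add: DERIV_imp_deriv)
  qed
  have H: "h has_fps_expansion fps_expansion h 0"
    using h by (intro has_fps_expansion_disc)
  have "(\<lambda>z. z * deriv h z) has_fps_expansion fps_X * fps_deriv (fps_expansion h 0)"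
    by (intro fps_expansion_intros H)
  moreover have "(\<lambda>z. z * deriv h z) has_fps_expansion fps_expansion h 0 * (1 + fps_X * fps_deriv \<Lambda>)"
    by (rule has_fps_expansion_disc_cong[where f = "\<lambda>z. h z * (1 + z * deriv L z)" and r = r],
        intro fps_expansion_intros H Lf) (use eq h(3) in auto)
  ultimately show ?thesis unfolding \<Lambda>_def using fps_expansion_unique_complex by blast
qed

text \<open>The quotient \<open>h z / z\<close> extends to a zero-free holomorphic \<open>k\<close>
  on the disc, and a zero-free function on a convex set has a holomorphic logarithm.\<close>

lemma ex_log_coeffs:
  assumes h: "h holomorphic_on ball 0 r" "h 0 = 0" "0 < r" and h1: "deriv h 0 = 1"
    and nz: "\<And>z. z \<in> ball 0 r \<Longrightarrow> z \<noteq> 0 \<Longrightarrow> h z \<noteq> 0"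
  shows "\<exists>c. has_log_coeffs h r c"
proof -
  obtain k where k: "k holomorphic_on ball 0 r" "\<And>z. norm z < r \<Longrightarrow> h z = z * k z" "deriv h 0 = k 0"
    using Schwarz3[OF h(1,2)] by blast
  have "k z \<noteq> 0" if "z \<in> ball 0 r" for z
    using nz[OF that] k(2)[of z] k(3) h1 that by (cases "z = 0") auto
  then obtain g where g: "g holomorphic_on ball 0 r" "\<And>z. z \<in> ball 0 r \<Longrightarrow> exp (g z) = k z"
    using holomorphic_logarithm_exists[OF convex_ball open_ball k(1), of 0] h(3) by auto
  \<comment> \<open>Subtracting \<open>g 0\<close> selects the branch with value 0 at the origin;
    the exponential is unchanged because \<open>exp (g 0) = k 0 = 1\<close>.\<close>
  define L where "L z = g z - g 0" for z
  define c where "c n = (if n = 0 then 0 else fps_nth (fps_expansion L 0) n / 2)" for n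
  have L: "L holomorphic_on ball 0 r" unfolding L_def by (intro holomorphic_intros g)
  have "exp (L z) = h z / z" if "z \<in> ball 0 r - {0}" for z
    using that g(2)[of z] g(2)[of 0] k(2)[of z] k(3) h1 h(3) by (simp add: L_def exp_diff)
  moreover have "(\<lambda>n. 2 * (c (Suc n) * z ^ Suc n)) sums L z" if z: "z \<in> ball 0 r" for z
  proof -
    have "(\<lambda>n. fps_nth (fps_expansion L 0) n * z ^ n) sums L z"
      using z L h(3) by (intro has_fps_expansion_imp_sums_complex[where r = r] has_fps_expansion_disc) auto
    moreover have "fps_nth (fps_expansion L 0) 0 = 0" by (simp add: fps_expansion_def L_def)
    ultimately show ?thesis
      using sums_Suc_iff[of "\<lambda>n. fps_nth (fps_expansion L 0) n * z ^ n"] by (simp add: c_def)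
  qed
  ultimately show ?thesis unfolding has_log_coeffs_def using L
    by (intro exI[of _ c] conjI exI[of _ L]) (auto simp: c_def L_def)
qed

text \<open>This makes the definite description in \<open>log_coeff\<close> and
  \<open>log_inv_coeff\<close> meaningful. Formal power series form a domain, so the nonzero series
  of \<open>h\<close> cancels from \<open>log_coeffs_fps\<close> and the derivatives of both series
  agree; the lost constant term is fixed by \<open>c 0 = 0\<close>.\<close>

lemma ex1_log_coeffs:
  assumes h: "h holomorphic_on ball 0 r" "h 0 = 0" "0 < r" and h1: "deriv h 0 = 1"
    and nz: "\<And>z. z \<in> ball 0 r \<Longrightarrow> z \<noteq> 0 \<Longrightarrow> h z \<noteq> 0"
  shows "\<exists>!c. has_log_coeffs h r c"
proof (rule ex_ex1I[OF ex_log_coeffs[OF assms]])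
  fix c d assume cd: "has_log_coeffs h r c" "has_log_coeffs h r d"
  let ?H = "fps_expansion h 0"
  have "fps_nth ?H 1 \<noteq> 0" by (simp add: fps_expansion_def h1)
  then have "?H \<noteq> 0" by auto
  have "?H * (1 + fps_X * fps_deriv (Abs_fps (\<lambda>n. 2 * c n))) =
      ?H * (1 + fps_X * fps_deriv (Abs_fps (\<lambda>n. 2 * d n)))"
    unfolding log_coeffs_fps[OF h cd(1), symmetric] log_coeffs_fps[OF h cd(2), symmetric] ..
  then have "1 + fps_X * fps_deriv (Abs_fps (\<lambda>n. 2 * c n)) = 1 + fps_X * fps_deriv (Abs_fps (\<lambda>n. 2 * d n))"
    using \<open>?H \<noteq> 0\<close> by (rule mult_left_cancel[THEN iffD1, rotated])
  then have "fps_X * fps_deriv (Abs_fps (\<lambda>n. 2 * c n)) = fps_X * fps_deriv (Abs_fps (\<lambda>n. 2 * d n))"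
    by (rule add_left_imp_eq)
  then have eq: "fps_deriv (Abs_fps (\<lambda>n. 2 * c n)) = fps_deriv (Abs_fps (\<lambda>n. 2 * d n))"
    by (rule mult_left_cancel[THEN iffD1, rotated]) simp
  show "c = d"
  proof
    fix n show "c n = d n"
    proof (cases n)
      case 0 then show ?thesis using cd by (simp add: has_log_coeffs_def)
    next
      case (Suc m)
      have "fps_nth (fps_deriv (Abs_fps (\<lambda>n. 2 * c n))) m = fps_nth (fps_deriv (Abs_fps (\<lambda>n. 2 * d n))) m"
        by (simp only: eq)
      then show ?thesis by (simp add: Suc del: of_nat_Suc)
    qed
  qed
qed

text \<open>Compare the coefficients of \<open>z^2\<close> and \<open>z^3\<close> in
  \<open>log_coeffs_fps\<close>; differentiating the logarithmic series turns \<open>2 * c 1\<close>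
  and \<open>2 * c 2\<close> into the weights \<open>2 * c 1\<close> and
  \<open>4 * c 2\<close>.\<close>

lemma the_log_coeffs:
  assumes h: "h holomorphic_on ball 0 r" "h 0 = 0" "0 < r" and h1: "deriv h 0 = 1"
    and nz: "\<And>z. z \<in> ball 0 r \<Longrightarrow> z \<noteq> 0 \<Longrightarrow> h z \<noteq> 0"
  shows "(THE c. has_log_coeffs h r c) 1 = taylor_coeff h 2 / 2"
    and "(THE c. has_log_coeffs h r c) 2 = (taylor_coeff h 3 - (taylor_coeff h 2)\<^sup>2 / 2) / 2"
proof -
  let ?c = "THE c. has_log_coeffs h r c" and ?H = "fps_expansion h 0"
  have c: "has_log_coeffs h r ?c" using theI'[OF ex1_log_coeffs[OF assms]] .
  note eq = log_coeffs_fps[OF h c]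
  have H: "fps_nth ?H 0 = 0" "fps_nth ?H 1 = 1" by (simp_all add: fps_expansion_def h h1)
  have "fps_nth (fps_X * fps_deriv ?H) 2 = fps_nth ?H 2 + 2 * ?c 1"
    unfolding eq fps_mult_nth using H by (simp add: eval_nat_numeral fps_mult_nth)
  then have c1: "fps_nth ?H 2 = 2 * ?c 1" by (simp add: eval_nat_numeral)
  have "fps_nth (fps_X * fps_deriv ?H) 3 = fps_nth ?H 3 + fps_nth ?H 2 * (2 * ?c 1) + 4 * ?c 2"
    unfolding eq fps_mult_nth using H by (simp add: eval_nat_numeral fps_mult_nth)
  then have c2: "2 * fps_nth ?H 3 = fps_nth ?H 2 * (2 * ?c 1) + 4 * ?c 2" by (simp add: eval_nat_numeral)
  show "?c 1 = taylor_coeff h 2 / 2" using c1 by (simp add: fps_nth_fps_expansion_eq)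
  show "?c 2 = (taylor_coeff h 3 - (taylor_coeff h 2)\<^sup>2 / 2) / 2"
  proof -
    have "4 * ?c 2 = 2 * fps_nth ?H 3 - fps_nth ?H 2 * fps_nth ?H 2" using c2 unfolding c1 by simp
    then have "?c 2 = (2 * fps_nth ?H 3 - fps_nth ?H 2 * fps_nth ?H 2) / 4"
      by (metis nonzero_mult_div_cancel_left zero_neq_numeral)
    then show ?thesis by (simp add: fps_nth_fps_expansion_eq power2_eq_square diff_divide_distrib)
  qed
qed

section \<open>Second and third Taylor coefficients of the inverse function and of
  \<open>f\<close>\<close>

text \<open>The first three coefficients of the formal composition \<open>?F oo ?G = fps_X\<close>
  are solved one after another. The two radii are independent, since the inverse is only considered
  on a smaller disc.\<close>

lemma taylor_coeff_inverse:
  assumes f: "f holomorphic_on ball 0 r" "0 < r" "f 0 = 0" "deriv f 0 = 1"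
    and g: "g holomorphic_on ball 0 s" "0 < s" "g 0 = 0"
    and fg: "\<And>z. z \<in> ball 0 s \<Longrightarrow> f (g z) = z"
  shows "deriv g 0 = 1" "taylor_coeff g 2 = - taylor_coeff f 2"
    "taylor_coeff g 3 = 2 * (taylor_coeff f 2)\<^sup>2 - taylor_coeff f 3"
proof -
  let ?F = "fps_expansion f 0" and ?G = "fps_expansion g 0"
  have F: "fps_nth ?F 0 = 0" "fps_nth ?F (Suc 0) = 1" and G0: "fps_nth ?G 0 = 0"
    by (simp_all add: fps_expansion_def f g)
  have "(f \<circ> g) has_fps_expansion (?F oo ?G)"
    using f g G0 by (intro has_fps_expansion_compose has_fps_expansion_disc)
  moreover have "(f \<circ> g) has_fps_expansion fps_X"
    by (rule has_fps_expansion_disc_cong[where f = "\<lambda>z. z" and r = s], intro fps_expansion_intros)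
       (use fg g in auto)
  ultimately have eq: "?F oo ?G = fps_X" using fps_expansion_unique_complex by blast
  have "fps_nth (?F oo ?G) 1 = 1" by (simp add: eq)
  then have G1: "fps_nth ?G 1 = 1" using F G0 by (simp add: fps_compose_nth)
  have "fps_nth (?F oo ?G) 2 = 0" by (simp add: eq)
  then have G2: "fps_nth ?G 2 = - fps_nth ?F 2" 
    using F G0 G1 by (simp add: fps_compose_nth fps_mult_nth eval_nat_numeral add_eq_0_iff)
  have "fps_nth (?F oo ?G) 3 = 0" by (simp add: eq)
  then have G3: "fps_nth ?G 3 + 2 * fps_nth ?F 2 * fps_nth ?G 2 + fps_nth ?F 3 = 0"
    using F G0 G1 by (simp add: fps_compose_nth fps_mult_nth eval_nat_numeral algebra_simps)
  show "deriv g 0 = 1" using G1 by (simp add: fps_expansion_def)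
  show "taylor_coeff g 2 = - taylor_coeff f 2" using G2 by (simp add: fps_nth_fps_expansion_eq)
  then show "taylor_coeff g 3 = 2 * (taylor_coeff f 2)\<^sup>2 - taylor_coeff f 3"
    using G3 by (simp add: fps_nth_fps_expansion_eq power2_eq_square algebra_simps add_eq_0_iff2)
qed

text \<open>Clearing the denominator gives \<open>2 z f'(z) = (f(z) - f(-z)) exp (w z)\<close>,
  whose coefficients at \<open>z^2\<close> and \<open>z^3\<close> determine those of
  \<open>f\<close>.\<close>

lemma taylor_coeff_of_sym_quotient:
  assumes f: "f \<in> class_S" and w: "w holomorphic_on unit_disc" "w 0 = 0"
    and q: "\<And>z. z \<in> unit_disc \<Longrightarrow> sym_quotient f z = exp (w z)"
  shows "taylor_coeff f 2 = taylor_coeff w 1 / 2"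
    and "taylor_coeff f 3 = taylor_coeff w 2 / 2 + (taylor_coeff w 1)\<^sup>2 / 4"
proof -
  have fs: "f holomorphic_on unit_disc" "inj_on f unit_disc" "f 0 = 0" "deriv f 0 = 1"
    using f by (auto simp: class_S_def)
  let ?F = "fps_expansion f 0" and ?W = "fps_expansion w 0"
  define Q where "Q = fps_expansion (\<lambda>z. exp (w z)) 0"
  have W: "w has_fps_expansion ?W" and F: "f has_fps_expansion ?F"
    using w fs by (auto intro: has_fps_expansion_disc)
  have Qf: "(\<lambda>z. exp (w z)) has_fps_expansion Q"
    unfolding Q_def by (rule has_fps_expansion_disc[of _ 1]) (intro holomorphic_intros w, simp)
  have "deriv (\<lambda>z. exp (w z)) has_fps_expansion fps_deriv Q"
    by (intro fps_expansion_intros Qf)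
  moreover have "deriv (\<lambda>z. exp (w z)) has_fps_expansion fps_deriv ?W * Q"
  proof (rule has_fps_expansion_disc_cong[where f = "\<lambda>z. deriv w z * exp (w z)" and r = 1])
    fix z :: complex assume "z \<in> unit_disc"
    then have "(w has_field_derivative deriv w z) (at z)"
      using w(1) by (intro holomorphic_derivI[of _ unit_disc]) auto
    then have "((\<lambda>z. exp (w z)) has_field_derivative deriv w z * exp (w z)) (at z)"
      by (auto intro!: derivative_eq_intros)
    then show "deriv w z * exp (w z) = deriv (\<lambda>z. exp (w z)) z" by (simp add: DERIV_imp_deriv)
  qed (intro fps_expansion_intros W Qf, simp)
  \<comment> \<open>The differential equation of \<open>exp (w z)\<close> yields its coefficients
    recursively, without composing with the exponential series.\<close>
  ultimately have dQ: "fps_deriv Q = fps_deriv ?W * Q" using fps_expansion_unique_complex by blast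
  have Q0: "fps_nth Q 0 = 1" by (simp add: Q_def fps_expansion_def w)
  have "fps_nth (fps_deriv Q) 0 = fps_nth ?W 1" unfolding dQ by (simp add: Q0)
  then have Q1: "fps_nth Q 1 = fps_nth ?W 1" by simp
  have "fps_nth (fps_deriv Q) 1 = 2 * fps_nth ?W 2 + (fps_nth ?W 1)\<^sup>2"
    unfolding dQ using Q0 Q1 by (simp add: fps_mult_nth power2_eq_square eval_nat_numeral)
  then have Q2: "2 * fps_nth Q 2 = 2 * fps_nth ?W 2 + (fps_nth ?W 1)\<^sup>2" by (simp add: eval_nat_numeral)
  have "(f \<circ> uminus) has_fps_expansion (?F oo (- fps_X))"
    by (intro has_fps_expansion_compose F fps_expansion_intros) simp
  then have Fm: "(\<lambda>z. f (- z)) has_fps_expansion (?F oo (- fps_X))" by (simp add: o_def)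
  have eq: "2 * (z * deriv f z) = (f z - f (- z)) * exp (w z)" if z: "z \<in> unit_disc" for z
  proof (cases "z = 0")
    case False
    then have "f z - f (- z) \<noteq> 0"
      using inj_onD[OF fs(2), of z "- z"] z by auto
    then show ?thesis using q[OF z] False by (simp add: sym_quotient_def field_simps)
  qed simp
  have "(\<lambda>z. 2 * (z * deriv f z)) has_fps_expansion 2 * (fps_X * fps_deriv ?F)"
    by (intro fps_expansion_intros F)
  moreover have "(\<lambda>z. 2 * (z * deriv f z)) has_fps_expansion (?F - (?F oo (- fps_X))) * Q"
    by (rule has_fps_expansion_disc_cong[where f = "\<lambda>z. (f z - f (- z)) * exp (w z)" and r = 1],
        intro fps_expansion_intros F Fm Qf) (use eq in auto)
  ultimately have E: "2 * (fps_X * fps_deriv ?F) = (?F - (?F oo (- fps_X))) * Q"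
    using fps_expansion_unique_complex by blast
  have F01: "fps_nth ?F 0 = 0" "fps_nth ?F (Suc 0) = 1" by (simp_all add: fps_expansion_def fs)
  define D where "D = ?F - (?F oo (- fps_X))"
  \<comment> \<open>Only the odd coefficients survive, doubled. Hence the third coefficient of
    \<open>f\<close> occurs on both sides of \<open>E\<close>, as 6 and 2 times itself, which leaves
    the factor 4 below.\<close>
  have Dn: "fps_nth D n = (if even n then 0 else 2 * fps_nth ?F n)" for n
    by (simp add: D_def fps_compose_uminus')
  have D: "fps_nth D 0 = 0" "fps_nth D 1 = 2" "fps_nth D 2 = 0" "fps_nth D 3 = 2 * fps_nth ?F 3"
    using F01 by (simp_all add: Dn)
  note E = E[folded D_def]
  have "fps_nth (2 * (fps_X * fps_deriv ?F)) 2 = 2 * fps_nth Q 1"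
    unfolding E fps_mult_nth using D by (simp add: eval_nat_numeral)
  then have "4 * fps_nth ?F 2 = 2 * fps_nth Q 1" by (simp add: eval_nat_numeral numeral_fps_const)
  then show "taylor_coeff f 2 = taylor_coeff w 1 / 2"
    unfolding Q1 fps_nth_fps_expansion_eq by (simp add: field_simps)
  have "fps_nth (2 * (fps_X * fps_deriv ?F)) 3 = 2 * fps_nth Q 2 + 2 * fps_nth ?F 3"
    unfolding E fps_mult_nth using D Q0 by (simp add: eval_nat_numeral)
  then have "4 * fps_nth ?F 3 = 2 * fps_nth Q 2" by (simp add: eval_nat_numeral numeral_fps_const)
  then show "taylor_coeff f 3 = taylor_coeff w 2 / 2 + (taylor_coeff w 1)\<^sup>2 / 4"
    using Q2 by (simp add: fps_nth_fps_expansion_eq field_simps)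
qed

subsection \<open>The disc of radius one quarter\<close>

lemma has_field_derivative_minus_arg:
  fixes f :: "complex \<Rightarrow> complex"
  assumes "(f has_field_derivative D) (at (- z))"
  shows "((\<lambda>z. f (- z)) has_field_derivative - D) (at z)"
proof -
  have "(uminus has_field_derivative - 1) (at z)" by (auto intro!: derivative_eq_intros)
  from DERIV_chain2[where g = uminus, OF assms this] show ?thesis by simp
qed

lemma holomorphic_on_minus_arg:
  assumes "f holomorphic_on ball 0 r"
  shows "(\<lambda>z. f (- z)) holomorphic_on ball 0 r"
proof -
  have "uminus holomorphic_on ball (0::complex) r"
    using holomorphic_on_minus[OF holomorphic_on_ident] .
  then show ?thesis
    using holomorphic_on_compose_gen[OF _ assms, of uminus "ball 0 r"] unfolding o_def
    by (simp add: image_subset_iff)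
qed

text \<open>A relation \<open>z * h z = c z\<close> says nothing directly about \<open>h 0\<close>.
  But \<open>h 0\<close> is the derivative of \<open>c\<close> at 0, and evenness of
  \<open>c\<close> makes it equal to its own negative.\<close>

lemma even_quotient_eq_0_at_0:
  fixes h :: "complex \<Rightarrow> complex"
  assumes h: "h holomorphic_on ball 0 r" "0 < r"
    and c: "\<And>z. z \<in> ball 0 r \<Longrightarrow> z * h z = c z" "\<And>z. c (- z) = c z"
  shows "h 0 = 0"
proof -
  have "((\<lambda>z. z * h z) has_field_derivative h 0) (at 0)"
    using holomorphic_derivI[OF h(1) open_ball, of 0] h(2) by (auto intro!: derivative_eq_intros)
  then have d: "(c has_field_derivative h 0) (at 0)"
    by (rule has_field_derivative_transform_within_open[of _ _ _ "ball 0 r"]) (use c h in auto)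
  then have "((\<lambda>z. c (- z)) has_field_derivative - h 0) (at 0)"
    by (intro has_field_derivative_minus_arg) simp
  then have "(c has_field_derivative - h 0) (at 0)" by (simp add: c(2))
  from DERIV_unique[OF d this] show ?thesis by (simp add: eq_neg_iff_add_eq_0)
qed

lemma cos_ge_quadratic: "1 - x\<^sup>2 / 2 \<le> cos (x::real)"
proof -
  have "cos x = 1 - 2 * (sin (x / 2))\<^sup>2"
    using cos_double_sin[of "x / 2"] by simp
  moreover have "(sin (x / 2))\<^sup>2 \<le> (x / 2)\<^sup>2"
    by (rule abs_le_square_iff[THEN iffD1, OF abs_sin_x_le_abs_x])
  ultimately show ?thesis by (simp add: power_divide)
qed

text \<open>With \<open>w = u + i v\<close> and \<open>r = norm w\<close>, use
  \<open>cos v >= 1 - v^2/2\<close> and, for negative \<open>u\<close>, also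
  \<open>exp u >= 1 + u\<close>; the product is then at least \<open>1 + u - v^2/2\<close>.\<close>

lemma Re_exp_ge:
  assumes "norm w \<le> 1"
  shows "1 - norm w \<le> Re (exp w)"
proof -
  define u v r where "u = Re w" and "v = Im w" and "r = norm w"
  have r2: "r\<^sup>2 = u\<^sup>2 + v\<^sup>2" by (simp add: r_def u_def v_def cmod_power2)
  have r: "0 \<le> r" "r \<le> 1" "\<bar>u\<bar> \<le> r" "\<bar>v\<bar> \<le> r"
    using assms by (auto simp: r_def u_def v_def abs_Re_le_cmod abs_Im_le_cmod)
  have v2: "v\<^sup>2 \<le> r" "v\<^sup>2 \<le> 1"
  proof -
    have "v\<^sup>2 \<le> r\<^sup>2" using r2 by simp
    also have "r\<^sup>2 \<le> r" using r by (simp add: power2_eq_square mult_left_le)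
    finally show "v\<^sup>2 \<le> r" .
    then show "v\<^sup>2 \<le> 1" using r by simp
  qed
  have cosv: "1 - v\<^sup>2 / 2 \<le> cos v" by (rule cos_ge_quadratic)
  have "1 - r \<le> exp u * cos v"
  proof (cases "0 \<le> u")
    case True
    have "1 - r \<le> cos v" using cosv v2 r by linarith
    also have "\<dots> \<le> exp u * cos v" using True cosv v2 by (simp add: mult_le_cancel_right1)
    finally show ?thesis .
  next
    case False
    \<comment> \<open>Since \<open>r - u\<close> is at most 2, this identity gives
      \<open>v^2/2 <= r + u\<close>, just what turns \<open>1 + u - v^2/2\<close> into
      \<open>1 - r\<close>.\<close>
    have "(r + u) * (r - u) = v\<^sup>2" using r2 by (simp add: algebra_simps power2_eq_square)
    moreover have "(r + u) * (r - u) \<le> (r + u) * 2" using r by (intro mult_left_mono) linarith+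
    ultimately have "v\<^sup>2 / 2 \<le> r + u" by simp
    moreover have "0 \<le> (- u) * v\<^sup>2 / 2" using False by (intro divide_nonneg_nonneg mult_nonneg_nonneg) auto
    ultimately have "1 - r \<le> (1 + u) * (1 - v\<^sup>2 / 2)" by (simp add: algebra_simps)
    also have "\<dots> \<le> exp u * cos v"
      using cosv v2 r exp_ge_add_one_self[of u] by (intro mult_mono) linarith+
    finally show ?thesis .
  qed
  then show ?thesis by (simp add: Re_exp u_def v_def r_def)
qed

text \<open>Write \<open>deriv f z = k z * exp (w z)\<close> with
  \<open>k z = (f z - f (- z)) / (2 z)\<close>. Each factor has modulus at least
  \<open>exp (- norm z)\<close>: the second by the Schwarz lemma, the first by integrating its
  logarithmic derivative, which \<open>Re_exp_ge\<close> controls.\<close>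

lemma norm_deriv_ge_exp:
  assumes f: "f \<in> class_S_sym_exp" and z: "norm z < 1"
  shows "exp (- 2 * norm z) \<le> norm (deriv f z)"
proof -
  have fs: "f holomorphic_on unit_disc" "inj_on f unit_disc" "f 0 = 0" "deriv f 0 = 1"
    using f by (auto simp: class_S_sym_exp_def class_S_def)
  obtain w where w: "w holomorphic_on unit_disc" "w ` unit_disc \<subseteq> unit_disc" "w 0 = 0"
      and q: "\<And>z. z \<in> unit_disc \<Longrightarrow> sym_quotient f z = exp (w z)"
    using f unfolding class_S_sym_exp_def subordinate_def by blast
  have wlt: "norm (w z) < 1" if "norm z < 1" for z
    using that w(2) by (metis image_subset_iff mem_ball_0)
  have wle: "norm (w z) \<le> norm z" if "norm z < 1" for z
    using Schwarz_Lemma(1)[OF w(1,3) wlt that] .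
  define G where "G z = (f z - f (- z)) / 2" for z
  have Gh: "G holomorphic_on unit_disc"
    unfolding G_def by (intro holomorphic_intros fs holomorphic_on_minus_arg) auto
  have fd: "(f has_field_derivative deriv f z) (at z)" if "norm z < 1" for z
    using fs(1) that by (intro holomorphic_derivI[of _ unit_disc]) auto
  have Gd: "(G has_field_derivative (deriv f z + deriv f (- z)) / 2) (at z)" if "norm z < 1" for z
    unfolding G_def
    using DERIV_cdivide[OF DERIV_diff[OF fd[of z] has_field_derivative_minus_arg[OF fd[of "- z"]]], of 2] that
    by simp
  have G0: "G 0 = 0" by (simp add: G_def)
  obtain k where k: "k holomorphic_on unit_disc" "\<And>z. norm z < 1 \<Longrightarrow> G z = z * k z" "deriv G 0 = k 0"
    using Schwarz3[OF Gh G0] by blast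
  have k0: "k 0 = 1" using k(3) DERIV_imp_deriv[OF Gd[of 0]] fs by simp
  have fne: "f z \<noteq> f (- z)" if "norm z < 1" "z \<noteq> 0" for z
    using inj_onD[OF fs(2), of z "- z"] that by auto
  have knz: "k z \<noteq> 0" if "z \<in> unit_disc" for z
    using k(2)[of z] fne[of z] k0 that by (cases "z = 0") (auto simp: G_def)
  have keven: "k (- z) = k z" if "norm z < 1" for z
  proof (cases "z = 0")
    case False
    have "G (- z) = - G z" by (simp add: G_def field_simps)
    then show ?thesis using k(2)[of z] k(2)[of "- z"] that False by simp
  qed simp
  have df: "deriv f z = k z * exp (w z)" if "norm z < 1" for z
  proof (cases "z = 0")
    case True then show ?thesis using fs k0 w by simp
  next
    case False
    have "f z - f (- z) = 2 * (z * k z)" using k(2)[OF that] by (simp add: G_def)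
    then show ?thesis using q[of z] that False knz[of z]
      by (simp add: sym_quotient_def field_simps)
  qed
  define c where "c z = (exp (w z) + exp (w (- z))) / 2" for z
  have dG: "(G has_field_derivative k z * c z) (at z)" if "norm z < 1" for z
    using Gd[OF that] df[of z] df[of "- z"] keven[OF that] that
    by (simp add: c_def algebra_simps)
  obtain g where g: "g holomorphic_on unit_disc" "\<And>z. z \<in> unit_disc \<Longrightarrow> exp (g z) = k z"
    using holomorphic_logarithm_exists[OF convex_ball open_ball k(1) knz, of 0] by auto
  have gd: "(g has_field_derivative deriv g z) (at z)" if "norm z < 1" for z
    using g(1) that by (intro holomorphic_derivI[of _ unit_disc]) auto
  \<comment> \<open>\<open>g\<close> is a logarithm of \<open>(f(z) - f(-z)) / (2 z)\<close>.\<close>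
  have zg: "z * deriv g z = c z - 1" if "norm z < 1" for z
  proof -
    have "((\<lambda>z. z * exp (g z)) has_field_derivative exp (g z) * (1 + z * deriv g z)) (at z)"
      by (rule derivative_eq_intros gd that refl)+ (simp add: algebra_simps)
    then have "(G has_field_derivative exp (g z) * (1 + z * deriv g z)) (at z)"
      by (rule has_field_derivative_transform_within_open[of _ _ _ unit_disc])
         (use that g k in auto)
    from DERIV_unique[OF this dG[OF that]] knz[of z] g(2)[of z] that
    have "k z * (1 + z * deriv g z) = k z * c z" by simp
    then show ?thesis using knz[of z] that by (simp add: eq_diff_eq add.commute)
  qed
  have g'0: "deriv g 0 = 0"
    by (rule even_quotient_eq_0_at_0[of _ 1 "\<lambda>z. c z - 1"], intro holomorphic_deriv g(1))
       (auto simp: c_def zg add.commute)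
  \<comment> \<open>The mean value theorem gives a point \<open>u = t z\<close>. Since
    \<open>zg\<close> bounds the real part of \<open>u * deriv g u = t * (deriv g u * z)\<close>
    below by \<open>- t * norm z\<close>, dividing by \<open>t\<close> suffices;
    \<open>t = 0\<close> is covered by \<open>g'0\<close>.\<close>
  have "\<exists>u. u \<in> closed_segment 0 z \<and> Re (g z) - Re (g 0) = Re (deriv g u * (z - 0))"
  proof (rule complex_mvt_line)
    fix u assume "u \<in> closed_segment 0 z"
    then have "norm u < 1" using z segment_bound1[of u 0 z] by simp
    then show "(g has_field_derivative deriv g u) (at u)" by (rule gd)
  qed
  then obtain t where t: "0 \<le> t" "t \<le> 1" and gt: "Re (g z) - Re (g 0) = Re (deriv g (of_real t * z) * z)"
    by (auto simp: in_segment scaleR_conv_of_real)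
  have "- norm z \<le> Re (deriv g (of_real t * z) * z)"
  proof (cases "t = 0")
    case True then show ?thesis by (simp add: g'0)
  next
    case False
    define u where "u = of_real t * z"
    have nu: "norm u = t * norm z" using t by (simp add: u_def norm_mult)
    have u1: "norm u < 1" using nu z t by (metis mult_left_le_one_le norm_ge_zero order_le_less_trans)
    have "1 - norm u \<le> 1 - norm (w u)" "1 - norm u \<le> 1 - norm (w (- u))"
      using wle[of u] wle[of "- u"] u1 by auto
    then have "1 - norm u \<le> Re (exp (w u))" "1 - norm u \<le> Re (exp (w (- u)))"
      using Re_exp_ge[of "w u"] Re_exp_ge[of "w (- u)"] wlt[of u] wlt[of "- u"] u1 by auto
    then have "- norm u \<le> (Re (exp (w u)) + Re (exp (w (- u)))) / 2 - 1" by (simp add: field_simps)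
    also have "\<dots> = Re (c u - 1)" by (simp add: c_def)
    also have "c u - 1 = of_real t * (deriv g u * z)"
      using zg[OF u1] by (simp add: u_def mult_ac)
    also have "Re \<dots> = t * Re (deriv g u * z)" by simp
    finally have "t * (- norm z) \<le> t * Re (deriv g u * z)" by (simp add: nu)
    then show ?thesis using False t unfolding u_def[symmetric]
      by (metis mult_le_cancel_left_pos order_le_less)
  qed
  moreover have "exp (Re (g 0)) = 1" using g(2)[of 0] k0 norm_exp_eq_Re[of "g 0"] by simp
  ultimately have "- norm z \<le> Re (g z)" using gt by simp
  moreover have "- norm z \<le> Re (w z)"
    using wle[OF z] abs_Re_le_cmod[of "w z"] by linarith
  ultimately have "exp (- 2 * norm z) \<le> exp (Re (g z + w z))" by simp
  also have "\<dots> = norm (deriv f z)"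
    using df[OF z] g(2)[of z] z by (simp add: norm_mult exp_add flip: norm_exp_eq_Re)
  finally show ?thesis .
qed

text \<open>The radius comes from the lower Riemann sum of \<open>exp (- 2 * t)\<close> for the partition
  \<open>0 < 3/10 < 7/10\<close>.\<close>

lemma quarter_covering:
  assumes f: "f \<in> class_S_sym_exp"
  shows "ball 0 (1/4) \<subseteq> f ` unit_disc"
proof -
  have fs: "f holomorphic_on unit_disc" "inj_on f unit_disc" "f 0 = 0"
    using f by (auto simp: class_S_sym_exp_def class_S_def)
  have m: "exp (- 2 * s) \<le> norm (deriv f z)" if "norm z \<le> s" "s < 1" for s z
  proof -
    have "exp (- 2 * s) \<le> exp (- 2 * norm z)" using that by simp
    also have "\<dots> \<le> norm (deriv f z)" using that by (intro norm_deriv_ge_exp[OF f]) simp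
    finally show ?thesis .
  qed
  \<comment> \<open>Both exponentials are powers of \<open>exp (- (1/10))\<close>, which is at least
    \<open>9/10\<close>; this reduces the estimate to rational arithmetic, where the sum is about
    0.2509.\<close>
  define x :: real where "x = exp (- (1/10))"
  have x: "9/10 \<le> x" using exp_ge_add_one_self[of "- (1/10)"] by (simp add: x_def)
  have e1: "exp (- 2 * (3/10)) = x ^ 6" and e2: "exp (- 2 * (7/10)) = x ^ 14"
    by (simp_all add: x_def flip: exp_of_nat_mult)
  have "cball 0 (0 + (3/10 - 0) * exp (- 2 * (3/10))) \<subseteq> f ` cball 0 (3/10)"
    using m[of _ "3/10"] by (intro covering_step[OF fs]) (auto simp: fs(3))
  then have "cball 0 (3/10 * x ^ 6) \<subseteq> f ` cball 0 (3/10)" by (simp only: e1) simp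
  then have "cball 0 (3/10 * x ^ 6 + (7/10 - 3/10) * exp (- 2 * (7/10))) \<subseteq> f ` cball 0 (7/10)"
    using m[of _ "7/10"] x by (intro covering_step[OF fs]) auto
  then have cov: "cball 0 (3/10 * x ^ 6 + 4/10 * x ^ 14) \<subseteq> f ` cball 0 (7/10)" by (simp only: e2) simp
  have "1/4 \<le> 3/10 * (9/10) ^ 6 + 4/10 * (9/10 :: real) ^ 14" by (simp add: power_divide)
  also have "\<dots> \<le> 3/10 * x ^ 6 + 4/10 * x ^ 14"
    using x by (intro add_mono mult_left_mono power_mono) auto
  finally have "ball 0 (1/4) \<subseteq> cball (0::complex) (3/10 * x ^ 6 + 4/10 * x ^ 14)" by auto
  also note cov
  also have "f ` cball 0 (7/10) \<subseteq> f ` unit_disc" by (intro image_mono) auto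
  finally show ?thesis .
qed

subsection \<open>Extremal functions\<close>

lemma ex_primitive:
  assumes "g holomorphic_on ball 0 r"
  shows "\<exists>G. G 0 = 0 \<and> (\<forall>z\<in>ball 0 r. (G has_field_derivative g z) (at z))"
proof (rule holomorphic_convex_primitive'[OF convex_ball open_ball assms])
  fix G assume G: "\<And>z. z \<in> ball 0 r \<Longrightarrow> (G has_field_derivative g z) (at z within ball 0 r)"
  have "((\<lambda>z. G z - G 0) has_field_derivative g z) (at z)" if z: "z \<in> ball 0 r" for z
  proof -
    have "(G has_field_derivative g z) (at z)" using G[OF z] at_within_open[OF z open_ball] by simp
    from DERIV_diff[OF this DERIV_const] show ?thesis by simp
  qed
  then show ?thesis by (intro exI[of _ "\<lambda>z. G z - G 0"]) simp
qed

text \<open>\<open>z * exp (E z)\<close> is the odd part of \<open>f\<close>, and its logarithmic derivative is governed by the even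
  part of \<open>exp \<circ> w\<close>.\<close>

lemma ex_sym_quotient:
  assumes w: "w holomorphic_on unit_disc" "w 0 = 0"
  obtains f E where "E holomorphic_on unit_disc" "E 0 = 0"
    "\<And>z. z \<in> unit_disc \<Longrightarrow> z * deriv E z = (exp (w z) + exp (w (- z))) / 2 - 1"
    "f 0 = 0" "\<And>z. z \<in> unit_disc \<Longrightarrow> (f has_field_derivative exp (w z + E z)) (at z)"
    "\<And>z. z \<in> unit_disc \<Longrightarrow> sym_quotient f z = exp (w z)"
proof -
  define c where "c z = (exp (w z) + exp (w (- z))) / 2 - 1" for z
  have c: "c holomorphic_on unit_disc"
    unfolding c_def by (intro holomorphic_intros w holomorphic_on_minus_arg) auto
  have ceven: "c (- z) = c z" for z by (simp add: c_def add.commute)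
  have c0: "c 0 = 0" by (simp add: c_def w)
  obtain h where h: "h holomorphic_on unit_disc" "\<And>z. norm z < 1 \<Longrightarrow> c z = z * h z" "deriv c 0 = h 0"
    using Schwarz3[OF c c0] by blast
  \<comment> \<open>This extends the oddness of \<open>h = c / z\<close> to the origin; the
    primitive \<open>E\<close> of \<open>h\<close> is then even.\<close>
  have "h 0 = 0" using even_quotient_eq_0_at_0[of h 1 c] h(1,2) ceven by simp
  then have hodd: "h (- z) = - h z" if "norm z < 1" for z
  proof (cases "z = 0")
    case False
    have "- (z * h (- z)) = z * h z" using h(2)[of z] h(2)[of "- z"] ceven[of z] that by simp
    then have "z * h z = z * (- h (- z))" by simp
    then have "h z = - h (- z)" using False by (metis mult_left_cancel)
    then show ?thesis by simp
  qed simp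
  obtain E where E0: "E 0 = 0" and Ed: "\<And>z. z \<in> unit_disc \<Longrightarrow> (E has_field_derivative h z) (at z)"
    using ex_primitive[OF h(1)] by metis
  have Eh: "E holomorphic_on unit_disc"
    using Ed by (meson holomorphic_on_open open_ball)
  have Eeven: "E (- z) = E z" if "z \<in> unit_disc" for z
  proof -
    have "\<exists>k. \<forall>z\<in>unit_disc. E (- z) - E z = k"
    proof (rule has_field_derivative_zero_constant[OF convex_ball])
      fix z :: complex assume z: "z \<in> unit_disc"
      then have "(E has_field_derivative h (- z)) (at (- z))" by (intro Ed) simp
      then have "((\<lambda>z. E (- z)) has_field_derivative - h (- z)) (at z)"
        by (rule has_field_derivative_minus_arg)
      from DERIV_diff[OF this Ed[OF z]] hodd[of z] z
      have "((\<lambda>z. E (- z) - E z) has_field_derivative 0) (at z)" by simp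
      then show "((\<lambda>z. E (- z) - E z) has_field_derivative 0) (at z within unit_disc)"
        by (rule has_field_derivative_at_within)
    qed
    then obtain k where k: "\<And>z. z \<in> unit_disc \<Longrightarrow> E (- z) - E z = k" by blast
    from k[of 0] k[OF that] show ?thesis by simp
  qed
  have hol: "(\<lambda>z. exp (w z + E z)) holomorphic_on unit_disc" by (intro holomorphic_intros w Eh)
  obtain f where f0: "f 0 = 0"
    and fd: "\<And>z. z \<in> unit_disc \<Longrightarrow> (f has_field_derivative exp (w z + E z)) (at z)"
    using ex_primitive[OF hol] by metis
  \<comment> \<open>Both sides vanish at 0 and have the same derivative, because \<open>E\<close> is
    even and \<open>1 + z E'(z)\<close> is the mean of \<open>exp (w z)\<close> and
    \<open>exp (w (- z))\<close>.\<close>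
  have diff: "f z - f (- z) = 2 * z * exp (E z)" if "z \<in> unit_disc" for z
  proof -
    have "\<exists>k. \<forall>z\<in>unit_disc. f z - f (- z) - 2 * z * exp (E z) = k"
    proof (rule has_field_derivative_zero_constant[OF convex_ball])
      fix z :: complex assume z: "z \<in> unit_disc"
      have "((\<lambda>z. 2 * z * exp (E z)) has_field_derivative 2 * (exp (E z) * (1 + c z))) (at z)"
        by (rule derivative_eq_intros Ed z refl)+ (use h(2)[of z] z in \<open>simp add: algebra_simps\<close>)
      moreover have "2 * (exp (E z) * (1 + c z)) = exp (w z + E z) + exp (w (- z) + E (- z))"
        by (simp add: Eeven[OF z] c_def exp_add field_simps)
      ultimately have g: "((\<lambda>z. 2 * z * exp (E z)) has_field_derivative
          exp (w z + E z) + exp (w (- z) + E (- z))) (at z)" by simp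
      have "(f has_field_derivative exp (w (- z) + E (- z))) (at (- z))" using z by (intro fd) simp
      then have "((\<lambda>z. f (- z)) has_field_derivative - exp (w (- z) + E (- z))) (at z)"
        by (rule has_field_derivative_minus_arg)
      from DERIV_diff[OF DERIV_diff[OF fd[OF z] this] g]
      have "((\<lambda>z. f z - f (- z) - 2 * z * exp (E z)) has_field_derivative 0) (at z)" by simp
      then show "((\<lambda>z. f z - f (- z) - 2 * z * exp (E z)) has_field_derivative 0) (at z within unit_disc)"
        by (rule has_field_derivative_at_within)
    qed
    then obtain k where k: "\<And>z. z \<in> unit_disc \<Longrightarrow> f z - f (- z) - 2 * z * exp (E z) = k" by blast
    from k[of 0] k[OF that] show ?thesis by simp
  qed
  show ?thesis
  proof (rule that[of E f])
    fix z :: complex assume z: "z \<in> unit_disc"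
    show "z * deriv E z = (exp (w z) + exp (w (- z))) / 2 - 1"
      using h(2)[of z] z DERIV_imp_deriv[OF Ed[OF z]] by (simp add: c_def)
    show "sym_quotient f z = exp (w z)"
      using diff[OF z] DERIV_imp_deriv[OF fd[OF z]] w by (simp add: sym_quotient_def exp_add)
    show "(f has_field_derivative exp (w z + E z)) (at z)" by (rule fd[OF z])
  qed (auto simp: E0 f0 Eh)
qed

text \<open>A uniform bound 57/100 on the disc gains the factor \<open>norm z\<close> by the Schwarz
  lemma. Taylor polynomials of degree 5 give \<open>(1 + 1/12 + 2 * 3/120) / 2\<close>, about
  0.5667, as the uniform bound.\<close>

lemma norm_cosh_diff_1_le:
  fixes z :: complex
  assumes "norm z < 1"
  shows "norm ((exp z + exp (- z)) / 2 - 1) \<le> 57/100 * norm z"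
proof -
  define g where "g z = ((exp z + exp (- z)) / 2 - 1) / (57/100)" for z :: complex
  have lt: "norm (g z) < 1" if z: "norm z < 1" for z :: complex
  proof -
    have T: "norm (exp x - (\<Sum>k\<le>5. x ^ k / fact k)) \<le> 3 / 120" if x: "norm x < 1" for x :: complex
    proof -
      have "norm (exp x - (\<Sum>k\<le>5. x ^ k / fact k)) \<le> exp \<bar>Re x\<bar> * norm x ^ Suc 5 / fact 5"
        by (rule Taylor_exp)
      also have "\<dots> \<le> 3 * 1 / fact 5"
      proof (intro divide_right_mono mult_mono)
        have "exp \<bar>Re x\<bar> \<le> exp 1" using abs_Re_le_cmod[of x] x by simp
        then show "exp \<bar>Re x\<bar> \<le> 3" using exp_le by linarith
        show "norm x ^ Suc 5 \<le> 1" using x by (intro power_le_one) auto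
      qed auto
      finally show ?thesis by (simp add: fact_numeral)
    qed
    let ?S = "\<lambda>x::complex. \<Sum>k\<le>5. x ^ k / fact k"
    have S: "?S z + ?S (- z) = 2 + z ^ 2 + z ^ 4 / 12"
      by (simp add: eval_nat_numeral field_simps)
    have "(exp z + exp (- z)) - 2 = (exp z - ?S z) + (exp (- z) - ?S (- z)) + z ^ 2 + z ^ 4 / 12"
      using S by (simp add: algebra_simps)
    also have "norm \<dots> \<le> 3 / 120 + 3 / 120 + 1 + 1 / 12"
    proof (intro norm_triangle_mono T)
      show "norm (z ^ 2) \<le> 1" "norm (z ^ 4 / 12) \<le> 1 / 12"
        using z by (simp_all add: norm_power norm_divide power_le_one)
    qed (use z in auto)
    finally have "norm (exp z + exp (- z) - 2) < 2 * (57/100)" by simp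
    moreover have "exp z + exp (- z) - 2 = 2 * (57/100) * g z" by (simp add: g_def field_simps)
    ultimately show ?thesis by (simp add: norm_mult)
  qed
  have "g holomorphic_on unit_disc" unfolding g_def by (intro holomorphic_intros) auto
  from Schwarz_Lemma(1)[OF this _ lt assms] have "norm (g z) \<le> norm z" by (simp add: g_def)
  moreover have eq: "(exp z + exp (- z)) / 2 - 1 = 57/100 * g z" by (simp add: g_def)
  ultimately show ?thesis unfolding eq norm_mult by simp
qed

text \<open>Since \<open>E'\<close> is at most 57/100 in modulus, so is \<open>E\<close>, and the
  argument of \<open>f' = exp (z + E z)\<close> stays below 1.57, which is just under
  \<open>pi / 2\<close>. So \<open>f'\<close> has positive real part.\<close>

lemma univalent_identity_case:
  assumes E: "E holomorphic_on unit_disc" "E 0 = 0"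
      "\<And>z. z \<in> unit_disc \<Longrightarrow> z * deriv E z = (exp z + exp (- z)) / 2 - 1"
    and f: "\<And>z. z \<in> unit_disc \<Longrightarrow> (f has_field_derivative exp (z + E z)) (at z)"
  shows "inj_on f unit_disc"
proof (rule inj_on_if_Re_deriv_pos[OF convex_ball f])
  fix z :: complex assume z: "z \<in> unit_disc"
  have "deriv E holomorphic_on unit_disc" using E(1) by (intro holomorphic_deriv) auto
  have bd: "norm (deriv E u) \<le> 57/100" if u: "u \<in> unit_disc - {0}" for u
  proof -
    have "norm u * norm (deriv E u) \<le> 57/100 * norm u"
      using E(3)[of u] norm_cosh_diff_1_le[of u] u by (simp flip: norm_mult)
    then show ?thesis using u by simp
  qed
  have "deriv E 0 = 0"
    by (rule even_quotient_eq_0_at_0[of _ 1 "\<lambda>z. (exp z + exp (- z)) / 2 - 1"], fact)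
       (auto simp: E add.commute)
  then have d0: "norm (deriv E 0) \<le> 57/100" by simp
  have "norm (E z - E 0) \<le> 57/100 * norm (z - 0)"
  proof (rule field_differentiable_bound[OF convex_ball])
    fix u :: complex assume u: "u \<in> unit_disc"
    show "(E has_field_derivative deriv E u) (at u within unit_disc)"
      using holomorphic_derivI[OF E(1) open_ball u] .
    show "norm (deriv E u) \<le> 57/100" using bd d0 u by (cases "u = 0") auto
  qed (use z in auto)
  also have "\<dots> \<le> 57/100" using z by simp
  finally have "norm (E z) \<le> 57/100" by (simp add: E)
  moreover have "\<bar>Im (z + E z)\<bar> \<le> norm z + norm (E z)"
    using abs_Im_le_cmod[of "z + E z"] norm_triangle_ineq[of z "E z"] by linarith
  ultimately have "\<bar>Im (z + E z)\<bar> < pi / 2" using z pi_approx(1) by simp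
  then have "cos (Im (z + E z)) > 0" by (intro cos_gt_zero_pi) linarith+
  then show "0 < Re (exp (z + E z))" by (simp add: Re_exp)
qed

text \<open>With \<open>z = exp s\<close>, \<open>log f(z)\<close> becomes the function \<open>s \<mapsto> s + E (exp s)\<close> on the left half
  plane, whose derivative \<open>exp (exp (2 * s))\<close> has positive real part.\<close>

lemma univalent_square_case:
  assumes E: "E holomorphic_on unit_disc"
      "\<And>z. z \<in> unit_disc \<Longrightarrow> z * deriv E z = exp (z\<^sup>2) - 1"
    and f: "f 0 = 0" "\<And>z. z \<in> unit_disc \<Longrightarrow> (f has_field_derivative exp (z\<^sup>2 + E z)) (at z)"
  shows "inj_on f unit_disc"
proof -
  have Ed: "(E has_field_derivative deriv E z) (at z)" if "z \<in> unit_disc" for z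
    using E(1) that by (intro holomorphic_derivI[of _ unit_disc]) auto
  have feq: "f z = z * exp (E z)" if "z \<in> unit_disc" for z
  proof -
    have "\<exists>k. \<forall>z\<in>unit_disc. f z - z * exp (E z) = k"
    proof (rule has_field_derivative_zero_constant[OF convex_ball])
      fix z :: complex assume z: "z \<in> unit_disc"
      have "((\<lambda>z. z * exp (E z)) has_field_derivative exp (E z) * (1 + z * deriv E z)) (at z)"
        by (rule derivative_eq_intros Ed z refl)+ (simp add: algebra_simps)
      from DERIV_diff[OF f(2)[OF z] this] E(2)[OF z]
      have "((\<lambda>z. f z - z * exp (E z)) has_field_derivative 0) (at z)" by (simp add: exp_add)
      then show "((\<lambda>z. f z - z * exp (E z)) has_field_derivative 0) (at z within unit_disc)"
        by (rule has_field_derivative_at_within)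
    qed
    then obtain k where k: "\<And>z. z \<in> unit_disc \<Longrightarrow> f z - z * exp (E z) = k" by blast
    from k[of 0] k[OF that] show ?thesis by (simp add: f)
  qed
  define H where "H = {s. Re s < 0}"
  define V where "V s = s + E (exp s)" for s
  have eH: "exp s \<in> unit_disc" if "s \<in> H" for s using that by (simp add: H_def)
  have "convex H" unfolding H_def by (rule convex_halfspace_Re_lt)
  have Vd: "(V has_field_derivative exp (exp (2 * s))) (at s)" if s: "s \<in> H" for s
  proof -
    have "(V has_field_derivative 1 + deriv E (exp s) * exp s) (at s)"
      unfolding V_def by (rule derivative_eq_intros DERIV_chain2[OF Ed] eH s refl)+ simp
    then show ?thesis using E(2)[OF eH[OF s]] by (simp add: mult.commute[of "exp s"] flip: exp_double)
  qed
  have injV: "inj_on V H"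
  proof (rule inj_on_if_Re_deriv_pos[OF \<open>convex H\<close> Vd])
    fix s assume "s \<in> H"
    then have "norm (exp (2 * s)) < 1" by (simp add: H_def)
    then have "\<bar>Im (exp (2 * s))\<bar> < pi / 2"
      using abs_Im_le_cmod[of "exp (2 * s)"] pi_gt3 by linarith
    then have "cos (Im (exp (2 * s))) > 0" by (intro cos_gt_zero_pi) linarith+
    then show "0 < Re (exp (exp (2 * s)))" by (simp add: Re_exp)
  qed
  show ?thesis
  proof (rule inj_onI)
    fix x y assume xy: "x \<in> unit_disc" "y \<in> unit_disc" "f x = f y"
    show "x = y"
    proof (cases "x = 0 \<or> y = 0")
      case True then show ?thesis using xy feq[of x] feq[of y] by auto
    next
      case False
      have LnH: "Ln z \<in> H" if "z \<in> unit_disc" "z \<noteq> 0" for z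
        using that by (simp add: H_def)
      have "exp (V (Ln x)) = exp (V (Ln y))"
        using False xy feq[of x] feq[of y] by (simp add: V_def exp_add)
      then obtain n :: int where n: "V (Ln x) = V (Ln y) + of_int (2 * n) * pi * \<i>"
        unfolding exp_eq by auto
      \<comment> \<open>The period is moved into the argument: \<open>t\<close> is another logarithm
        of \<open>y\<close> in the same half plane, and \<open>V t\<close> absorbs the multiple of 2
        pi i, so injectivity of \<open>V\<close> applies.\<close>
      define t where "t = Ln y + of_int (2 * n) * pi * \<i>"
      have et: "exp t = y" using False exp_eq[of t "Ln y"] by (auto simp: t_def)
      have "V (Ln x) = V t" using n et False by (simp add: V_def t_def)
      moreover have "t \<in> H" using LnH[of y] xy False by (simp add: t_def H_def)
      ultimately have "Ln x = t" using inj_onD[OF injV] LnH[of x] xy False by blast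
      then show ?thesis using et False by (metis exp_Ln)
    qed
  qed
qed

subsection \<open>Bounds for the determinants\<close>

lemma hermitian_toeplitz_2_1_real:
  assumes "c 1 \<in> \<real>"
  shows "hermitian_toeplitz_2_1 c = of_real ((Re (c 1))\<^sup>2 - (norm (c 2))\<^sup>2)"
proof -
  have "hermitian_toeplitz_2_1 c = c 1 * c 1 - c 2 * cnj (c 2)"
    by (simp add: hermitian_toeplitz_2_1_def det_2)
  also have "c 1 * c 1 = of_real ((Re (c 1))\<^sup>2)"
    using assms by (auto elim!: Reals_cases simp: power2_eq_square)
  finally show ?thesis by (simp only: complex_norm_square of_real_diff)
qed

text \<open>Here \<open>a\<close> is the first coefficient of the Schwarz function and
  \<open>c\<close> is plus or minus the second, so one estimate serves both determinants. With
  \<open>x = a^2\<close>, the lower bound uses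
  \<open>norm b <= x/16 + (1 - x)/4 <= 1/4\<close>.\<close>

lemma toeplitz_bounds:
  fixes a :: real and c b :: complex
  assumes a: "\<bar>a\<bar> \<le> 1" and c: "norm c \<le> 1 - a\<^sup>2" and b: "b = of_real (a\<^sup>2 / 16) + c / 4"
  shows "- 1 / 16 \<le> (a / 4)\<^sup>2 - (norm b)\<^sup>2" "(a / 4)\<^sup>2 - (norm b)\<^sup>2 \<le> 15 / 256"
proof -
  define x where "x = a\<^sup>2"
  have x: "0 \<le> x" "x \<le> 1" using a by (simp_all add: x_def abs_square_le_1)
  have eq: "(a / 4)\<^sup>2 = x / 16" by (simp add: power_divide x_def)
  have na: "norm (complex_of_real (a\<^sup>2 / 16)) = x / 16" unfolding norm_of_real x_def by simp
  have "norm b \<le> x / 16 + norm (c / 4)"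
    unfolding b using norm_triangle_ineq[of "of_real (a\<^sup>2 / 16)" "c / 4"] na by simp
  then have "norm b \<le> 1 / 4" using c x by (simp add: norm_divide flip: x_def)
  then have "(norm b)\<^sup>2 \<le> (1/4)\<^sup>2" by (intro power_mono) auto
  then show "- 1 / 16 \<le> (a / 4)\<^sup>2 - (norm b)\<^sup>2"
    using x unfolding eq by (simp add: power_divide)
  have lo: "(5 * x - 4) / 16 \<le> norm b"
    unfolding b using norm_diff_ineq[of "of_real (a\<^sup>2 / 16)" "c / 4"] na c
    by (simp add: norm_divide flip: x_def)
  show "(a / 4)\<^sup>2 - (norm b)\<^sup>2 \<le> 15 / 256"
  \<comment> \<open>The lower bound \<open>lo\<close> on \<open>norm b\<close> is informative only
    when \<open>5 x - 4\<close> is positive; otherwise \<open>x / 16 <= 1/20\<close> is already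
    below 15/256.\<close>
  proof (cases "x \<le> 4/5")
    case True
    then show ?thesis using zero_le_power2[of "norm b"] unfolding eq by linarith
  next
    case False
    then have "((5 * x - 4) / 16)\<^sup>2 \<le> (norm b)\<^sup>2" using lo by (intro power_mono) auto
    moreover have "x / 16 - ((5 * x - 4) / 16)\<^sup>2 \<le> 15 / 256"
    proof -
      \<comment> \<open>This product is 256 times the difference of the two sides.\<close>
      have "0 \<le> (1 - x) * (31 - 25 * x)" using x by (intro mult_nonneg_nonneg) auto
      then show ?thesis by (simp add: power2_eq_square field_simps)
    qed
    ultimately show ?thesis unfolding eq by linarith
  qed
qed

lemma class_coeffs:
  assumes "f \<in> class_S_sym_exp"
  obtains c1 c2 where "norm c1 \<le> 1" "norm c2 \<le> 1 - (norm c1)\<^sup>2"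
    "taylor_coeff f 2 = c1 / 2" "taylor_coeff f 3 = c2 / 2 + c1\<^sup>2 / 4"
proof -
  obtain w where w: "w holomorphic_on unit_disc" "w ` unit_disc \<subseteq> unit_disc" "w 0 = 0"
      "\<And>z. z \<in> unit_disc \<Longrightarrow> sym_quotient f z = exp (w z)"
    using assms unfolding class_S_sym_exp_def subordinate_def by blast
  have "f \<in> class_S" using assms by (simp add: class_S_sym_exp_def)
  from that[OF Schwarz_second_coeff[OF w(1-3)] taylor_coeff_of_sym_quotient[OF this w(1,3,4)]]
  show ?thesis by blast
qed

lemma log_coeff_values:
  assumes "f \<in> class_S"
  shows "log_coeff f 1 = taylor_coeff f 2 / 2"
    and "log_coeff f 2 = (taylor_coeff f 3 - (taylor_coeff f 2)\<^sup>2 / 2) / 2"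
proof -
  have f: "f holomorphic_on ball 0 1" "f 0 = 0" "0 < (1::real)" "deriv f 0 = 1"
    and inj: "inj_on f unit_disc" using assms by (auto simp: class_S_def)
  have "f z \<noteq> 0" if "z \<in> ball 0 1" "z \<noteq> 0" for z
    using inj_onD[OF inj, of z 0] that f(2) by auto
  from the_log_coeffs[OF f this]
  show "log_coeff f 1 = taylor_coeff f 2 / 2"
    "log_coeff f 2 = (taylor_coeff f 3 - (taylor_coeff f 2)\<^sup>2 / 2) / 2"
    by (simp_all add: log_coeff_def)
qed

lemma log_inv_coeff_values:
  assumes f: "f \<in> class_S" and cov: "ball 0 (1/4) \<subseteq> f ` unit_disc"
  shows "log_inv_coeff f 1 = - taylor_coeff f 2 / 2"
    and "log_inv_coeff f 2 = (3 / 2 * (taylor_coeff f 2)\<^sup>2 - taylor_coeff f 3) / 2"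
proof -
  have fs: "f holomorphic_on unit_disc" "f 0 = 0" "deriv f 0 = 1" and inj: "inj_on f unit_disc"
    using f by (auto simp: class_S_def)
  let ?g = "inv_into unit_disc f"
  obtain g where g: "g holomorphic_on f ` unit_disc" "\<And>z. z \<in> unit_disc \<Longrightarrow> g (f z) = z"
    using holomorphic_has_inverse[OF fs(1) open_ball inj] by metis
  \<comment> \<open>The inverse chosen by \<open>inv_into\<close> coincides on the image with the
    holomorphic inverse and so inherits holomorphy; \<open>cov\<close> then places the disc of
    radius 1/4 in that image.\<close>
  have "g y = ?g y" if "y \<in> f ` unit_disc" for y
    using that g(2) inv_into_f_f[OF inj] by auto
  then have "?g holomorphic_on f ` unit_disc" using g(1) by (simp cong: holomorphic_cong)
  then have gh: "?g holomorphic_on ball 0 (1/4)" using cov by (rule holomorphic_on_subset)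
  have g0: "?g 0 = 0" using inv_into_f_f[OF inj, of 0] fs by simp
  have fg: "f (?g z) = z" if "z \<in> ball 0 (1/4)" for z
    using that cov by (intro f_inv_into_f) auto
  have q: "0 < (1/4::real)" by simp
  note tc = taylor_coeff_inverse[OF fs(1) zero_less_one fs(2,3) gh q g0 fg]
  have "?g z \<noteq> 0" if "z \<in> ball 0 (1/4)" "z \<noteq> 0" for z
    using fg[OF that(1)] that(2) fs(2) by auto
  note lc = the_log_coeffs[OF gh g0 q tc(1) this]
  have c1: "log_inv_coeff f 1 = taylor_coeff ?g 2 / 2"
    unfolding log_inv_coeff_def by (rule lc(1))
  have c2: "log_inv_coeff f 2 = (taylor_coeff ?g 3 - (taylor_coeff ?g 2)\<^sup>2 / 2) / 2"
    unfolding log_inv_coeff_def by (rule lc(2))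
  have g: "taylor_coeff ?g 2 = - taylor_coeff f 2"
    "taylor_coeff ?g 3 = 2 * (taylor_coeff f 2)\<^sup>2 - taylor_coeff f 3"
    using tc(2,3) by simp_all
  show "log_inv_coeff f 1 = - taylor_coeff f 2 / 2"
    "log_inv_coeff f 2 = (3 / 2 * (taylor_coeff f 2)\<^sup>2 - taylor_coeff f 3) / 2"
    unfolding c1 c2 g by (simp_all add: field_simps)
qed

section \<open>Membership in the class and the two extremal functions\<close>

lemma class_S_sym_expI:
  assumes w: "w holomorphic_on unit_disc" "w ` unit_disc \<subseteq> unit_disc" "w 0 = 0"
    and E: "E 0 = 0" and f: "f 0 = 0" "inj_on f unit_disc"
      "\<And>z. z \<in> unit_disc \<Longrightarrow> (f has_field_derivative exp (w z + E z)) (at z)"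
    and q: "\<And>z. z \<in> unit_disc \<Longrightarrow> sym_quotient f z = exp (w z)"
  shows "f \<in> class_S_sym_exp"
proof -
  have "f holomorphic_on unit_disc" using f(3) by (meson holomorphic_on_open open_ball)
  moreover have "deriv f 0 = 1" using DERIV_imp_deriv[OF f(3)[of 0]] by (simp add: w E)
  ultimately have "f \<in> class_S" using f by (simp add: class_S_def)
  moreover have "sym_quotient f \<prec>\<^sub>s exp"
  proof -
    have "(\<lambda>z. exp (w z)) holomorphic_on unit_disc" by (intro holomorphic_intros w)
    then have "sym_quotient f holomorphic_on unit_disc"
      by (rule holomorphic_transform) (use q in simp)
    moreover have "exp holomorphic_on unit_disc" by (intro holomorphic_intros)
    ultimately show ?thesis unfolding subordinate_def using w q by blast
  qed
  ultimately show ?thesis by (simp add: class_S_sym_exp_def)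
qed

text \<open>The choice \<open>w z = z\<close> has Schwarz coefficients 1 and 0, the equality case
  \<open>x = 1\<close> of the upper bound: both second logarithmic coefficients equal 1/16.\<close>

lemma ex_extremal_identity:
  "\<exists>f\<in>class_S_sym_exp. taylor_coeff f 2 = 1 / 2 \<and> taylor_coeff f 3 = 1 / 4"
proof (rule ex_sym_quotient[where w = "\<lambda>z. z"])
  show w: "(\<lambda>z. z) holomorphic_on unit_disc" "(0::complex) = 0" by auto
  fix f E
  assume E: "E holomorphic_on unit_disc" "E 0 = 0"
      "\<And>z. z \<in> unit_disc \<Longrightarrow> z * deriv E z = (exp z + exp (- z)) / 2 - 1"
    and f: "f 0 = 0" "\<And>z. z \<in> unit_disc \<Longrightarrow> (f has_field_derivative exp (z + E z)) (at z)"
    and q: "\<And>z. z \<in> unit_disc \<Longrightarrow> sym_quotient f z = exp z"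
  have inj: "inj_on f unit_disc" by (rule univalent_identity_case[OF E f(2)])
  have mem: "f \<in> class_S_sym_exp"
    by (rule class_S_sym_expI[where w = "\<lambda>z. z" and E = E]) (use w E(2) f inj q in auto)
  then have "f \<in> class_S" by (simp add: class_S_sym_exp_def)
  note tc = taylor_coeff_of_sym_quotient[OF this w q]
  have "taylor_coeff (\<lambda>z. z) n = fps_nth fps_X n" for n
    by (rule taylor_coeff_eqI) (rule fps_expansion_intros)
  then show ?thesis using tc by (intro bexI[OF _ mem]) simp
qed

text \<open>The choice \<open>w z = z^2\<close> has Schwarz coefficients 0 and 1, so the diagonal
  entries vanish and both second logarithmic coefficients have modulus 1/4, which gives the lower
  bound.\<close>

lemma ex_extremal_square:
  "\<exists>f\<in>class_S_sym_exp. taylor_coeff f 2 = 0 \<and> taylor_coeff f 3 = 1 / 2"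
proof (rule ex_sym_quotient[where w = "\<lambda>z. z\<^sup>2"])
  show w: "(\<lambda>z. z\<^sup>2) holomorphic_on unit_disc" "(0::complex)\<^sup>2 = 0"
    by (auto intro!: holomorphic_intros)
  fix f E
  assume E: "E holomorphic_on unit_disc" "E 0 = 0"
      "\<And>z. z \<in> unit_disc \<Longrightarrow> z * deriv E z = (exp (z\<^sup>2) + exp ((- z)\<^sup>2)) / 2 - 1"
    and f: "f 0 = 0" "\<And>z. z \<in> unit_disc \<Longrightarrow> (f has_field_derivative exp (z\<^sup>2 + E z)) (at z)"
    and q: "\<And>z. z \<in> unit_disc \<Longrightarrow> sym_quotient f z = exp (z\<^sup>2)"
  have E': "z * deriv E z = exp (z\<^sup>2) - 1" if "z \<in> unit_disc" for z using E(3)[OF that] by simp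
  have inj: "inj_on f unit_disc" by (rule univalent_square_case[OF E(1) E' f])
  have mem: "f \<in> class_S_sym_exp"
  proof (rule class_S_sym_expI[where w = "\<lambda>z. z\<^sup>2" and E = E])
    show "(\<lambda>z. z\<^sup>2) ` unit_disc \<subseteq> unit_disc"
      by (auto simp: norm_power power_less_one_iff)
  qed (use w E(2) f inj q in auto)
  then have "f \<in> class_S" by (simp add: class_S_sym_exp_def)
  note tc = taylor_coeff_of_sym_quotient[OF this w q]
  have "taylor_coeff (\<lambda>z. z\<^sup>2) n = fps_nth (fps_X ^ 2) n" for n
    by (rule taylor_coeff_eqI) (rule fps_expansion_intros)
  then show ?thesis using tc by (intro bexI[OF _ mem]) simp
qed

theorem theorem3p1:
  shows
    "(\<forall>f\<in>class_S_sym_exp.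
        (taylor_coeff f 2 \<in> \<real> \<longleftrightarrow> log_coeff f 1 \<in> \<real>) \<and>
        (taylor_coeff f 2 \<in> \<real> \<longleftrightarrow> log_inv_coeff f 1 \<in> \<real>)) \<and>
     (\<forall>f\<in>class_S_sym_exp. taylor_coeff f 2 \<in> \<real> \<longrightarrow>
        (hermitian_toeplitz_2_1 (log_coeff f) \<in> \<real> \<and>
         - 1 / 16 \<le> Re (hermitian_toeplitz_2_1 (log_coeff f)) \<and>
         Re (hermitian_toeplitz_2_1 (log_coeff f)) \<le> 15 / 256) \<and>
        (hermitian_toeplitz_2_1 (log_inv_coeff f) \<in> \<real> \<and>
         - 1 / 16 \<le> Re (hermitian_toeplitz_2_1 (log_inv_coeff f)) \<and>
         Re (hermitian_toeplitz_2_1 (log_inv_coeff f)) \<le> 15 / 256)) \<and>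
     (\<exists>f\<in>class_S_sym_exp. taylor_coeff f 2 \<in> \<real> \<and>
        hermitian_toeplitz_2_1 (log_coeff f) = - 1 / 16) \<and>
     (\<exists>f\<in>class_S_sym_exp. taylor_coeff f 2 \<in> \<real> \<and>
        hermitian_toeplitz_2_1 (log_coeff f) = 15 / 256) \<and>
     (\<exists>f\<in>class_S_sym_exp. taylor_coeff f 2 \<in> \<real> \<and>
        hermitian_toeplitz_2_1 (log_inv_coeff f) = - 1 / 16) \<and>
     (\<exists>f\<in>class_S_sym_exp. taylor_coeff f 2 \<in> \<real> \<and>
        hermitian_toeplitz_2_1 (log_inv_coeff f) = 15 / 256)"
proof -
  have L: "log_coeff f 1 = taylor_coeff f 2 / 2"
      "log_coeff f 2 = (taylor_coeff f 3 - (taylor_coeff f 2)\<^sup>2 / 2) / 2"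
      "log_inv_coeff f 1 = - taylor_coeff f 2 / 2"
      "log_inv_coeff f 2 = (3 / 2 * (taylor_coeff f 2)\<^sup>2 - taylor_coeff f 3) / 2"
    if "f \<in> class_S_sym_exp" for f
    using that log_coeff_values[of f] log_inv_coeff_values[OF _ quarter_covering[OF that]]
    by (auto simp: class_S_sym_exp_def)
  have half: "x / 2 \<in> \<real> \<longleftrightarrow> x \<in> \<real>" "- x / 2 \<in> \<real> \<longleftrightarrow> x \<in> \<real>" for x :: complex
    by (auto simp: complex_is_Real_iff)
  have bounds: "hermitian_toeplitz_2_1 (log_coeff f) \<in> \<real> \<and>
         - 1 / 16 \<le> Re (hermitian_toeplitz_2_1 (log_coeff f)) \<and>
         Re (hermitian_toeplitz_2_1 (log_coeff f)) \<le> 15 / 256 \<and>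
       hermitian_toeplitz_2_1 (log_inv_coeff f) \<in> \<real> \<and>
         - 1 / 16 \<le> Re (hermitian_toeplitz_2_1 (log_inv_coeff f)) \<and>
         Re (hermitian_toeplitz_2_1 (log_inv_coeff f)) \<le> 15 / 256"
    if f: "f \<in> class_S_sym_exp" and real: "taylor_coeff f 2 \<in> \<real>" for f
  proof -
    obtain c1 c2 where c: "norm c1 \<le> 1" "norm c2 \<le> 1 - (norm c1)\<^sup>2"
        "taylor_coeff f 2 = c1 / 2" "taylor_coeff f 3 = c2 / 2 + c1\<^sup>2 / 4"
      using class_coeffs[OF f] by blast
    have "c1 \<in> \<real>" using real by (simp add: c half)
    then obtain a where a: "c1 = of_real a" by (auto elim: Reals_cases)
    \<comment> \<open>The bound on \<open>c2\<close> is invariant under sign change, and passing to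
      the inverse only replaces \<open>c2\<close> by \<open>- c2\<close> in the second logarithmic
      coefficient.\<close>
    have a': "\<bar>a\<bar> \<le> 1" "norm c2 \<le> 1 - a\<^sup>2" "norm (- c2) \<le> 1 - a\<^sup>2" using c a by auto
    have "log_coeff f 2 = of_real (a\<^sup>2 / 16) + c2 / 4"
      by (simp add: L[OF f] c a power_divide field_simps)
    note B1 = toeplitz_bounds[OF a'(1,2) this]
    have "log_inv_coeff f 2 = of_real (a\<^sup>2 / 16) + (- c2) / 4"
      by (simp add: L[OF f] c a power_divide field_simps)
    note B2 = toeplitz_bounds[OF a'(1,3) this]
    have "hermitian_toeplitz_2_1 (log_coeff f) = of_real ((a / 4)\<^sup>2 - (norm (log_coeff f 2))\<^sup>2)"
      by (subst hermitian_toeplitz_2_1_real) (simp_all add: L[OF f] c a complex_is_Real_iff del: One_nat_def)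
    moreover have "hermitian_toeplitz_2_1 (log_inv_coeff f) =
        of_real ((a / 4)\<^sup>2 - (norm (log_inv_coeff f 2))\<^sup>2)"
      by (subst hermitian_toeplitz_2_1_real) (simp_all add: L[OF f] c a complex_is_Real_iff del: One_nat_def)
    ultimately show ?thesis using B1 B2 by (simp del: of_real_diff of_real_power)
  qed
  obtain f where f: "f \<in> class_S_sym_exp" "taylor_coeff f 2 = 0" "taylor_coeff f 3 = 1 / 2"
    using ex_extremal_square by blast
  have f': "hermitian_toeplitz_2_1 (log_coeff f) = - 1 / 16"
      "hermitian_toeplitz_2_1 (log_inv_coeff f) = - 1 / 16"
    by (subst hermitian_toeplitz_2_1_real; simp add: L[OF f(1)] f power2_eq_square del: One_nat_def)+
  obtain g where g: "g \<in> class_S_sym_exp" "taylor_coeff g 2 = 1 / 2" "taylor_coeff g 3 = 1 / 4"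
    using ex_extremal_identity by blast
  have g': "hermitian_toeplitz_2_1 (log_coeff g) = 15 / 256"
      "hermitian_toeplitz_2_1 (log_inv_coeff g) = 15 / 256"
    by (subst hermitian_toeplitz_2_1_real; simp add: L[OF g(1)] g power2_eq_square del: One_nat_def)+
  have real: "(taylor_coeff h 2 \<in> \<real> \<longleftrightarrow> log_coeff h 1 \<in> \<real>) \<and>
      (taylor_coeff h 2 \<in> \<real> \<longleftrightarrow> log_inv_coeff h 1 \<in> \<real>)" if "h \<in> class_S_sym_exp" for h
    unfolding L(1,3)[OF that] half by simp
  have "taylor_coeff f 2 \<in> \<real>" "taylor_coeff g 2 \<in> \<real>" by (simp_all add: f g half)
  with real bounds f(1) f' g(1) g' show ?thesis by blast
qed

end
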